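(* There are absolute constants $c,K>0$ such that the following holds. Let $r\ge 2$ and $k\ge 2$ be integers, and let $d$ be an integer satisfying $3\le d\le \max\{3,\log(2r)\}$. If $$k\ge K\, r^{(2d^2-1)/(d-1)^2}\, d^{\,2d(2d-1)/(d-1)^2}\,\bigl(\log(2rd)\bigr)^{2d^2/(d-1)^2},$$ then $$R_r(k)\le \exp\!\left[-c\,\frac{k}{r^{2d/(d-1)}\,d^{4d/(d-1)}\,(\log(2rd))^{4/(d-1)}}\right] r^{rk}.$$
   Context: For integers $r,k\ge 2$, $R_r(k)$ denotes the diagonal $r$-color Ramsey number: the least integer $n$ such that every coloring of the edges of $K_n$ with $r$ colors contains a monochromatic copy of $K_k$. All logarithms are natural. The constants $c,K$ do not depend on $r$, $d$, $k$. *)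

theory Defs
  imports "HOL-Analysis.Analysis" "HOL-Library.Ramsey"
begin

text \<open>
  \<open>partn {..<n} k 2 {..<r}\<close> says that every map from the edges of \<open>K\<^sub>n\<close> to the
  \<open>r\<close> colors \<open>{..<r}\<close> has, for some color, a \<open>k\<close>-subset all of whose edges
  receive that color.
\<close>

definition ramsey_number :: "nat \<Rightarrow> nat \<Rightarrow> nat"
  where "ramsey_number r k = (LEAST n. partn {..<n} k 2 {..<r})"

text \<open>The minimum is taken over a nonempty set, so \<open>LEAST\<close> is never underspecified.\<close>

lemma ex_partn: "\<exists>n. partn {..<n::nat} k 2 {..<r::nat}"
proof -
  obtain n :: nat where "partn_lst {..<n} (replicate r k) 2"
    using ramsey_full by blast
  then have "partn {..<n} k 2 {..<r}"
    unfolding partn_lst_def partn_def by fastforce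
  then show ?thesis ..
qed

lemma partn_ramsey_number: "partn {..<ramsey_number r k} k 2 {..<r}"
  unfolding ramsey_number_def by (rule LeastI_ex) (rule ex_partn)

end

theory Submission
  imports Defs
begin

text \<open>
  The proof is a multicolour book algorithm in the style of Balister, Bollobas, Campos, Griffiths,
  Hurley, Morris, Sahasrabudhe and Tiba. Each step needs a vertex \<open>x\<close> whose colour neighbourhoods
  correlate positively with those of many other vertices. Correlations of colour \<open>i\<close> form a
  positive semidefinite kernel \<open>K\<^sub>i\<close>, so every polynomial with nonnegative coefficients has a
  nonnegative average over \<open>(K\<^sub>1, \<dots>, K\<^sub>r)\<close>. The polynomial is
  \<open>\<Sum>\<^sub>j (h(u\<^sub>j) - h(-u\<^sub>j)) \<Prod>\<^sub>i\<^sub>\<noteq>\<^sub>j h(u\<^sub>i)\<close> with \<open>h(u) = 1 + \<Prod>\<^sub>n (1 + u/2\<^sup>n)\<^sup>2\<^sup>m\<close> and \<open>m\<close> of order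
  \<open>log r\<close>: since \<open>h(-u) \<le> h(u)/(2r+1)\<close> for \<open>u \<ge> 1\<close>, it is negative as soon as some \<open>u\<^sub>j < -1\<close>,
  while \<open>h(z\<^sup>d)\<close> is at most \<open>2 exp (4 m d\<^sup>2 z)\<close>. Hence with probability \<open>exp (- O(m r d\<^sup>2 z))\<close>
  no colour correlates below \<open>-1\<close> and one correlates at least \<open>z\<^sup>d - 2\<close>.

  If some vertex has colour degree noticeably above the average, an Erdos--Szekeres step gains.
  Otherwise the book algorithm passes to a set of vertices avoiding a clique of size \<open>\<kappa>\<^sub>j - t\<close> in
  one colour \<open>j\<close> at almost no cost. One of the vectors \<open>\<kappa>\<close> and \<open>\<kappa> - t e\<^sub>j\<close> is unbalanced by order
  \<open>t\<close>, and for unbalanced clique sizes the Erdos--Szekeres bound gains a factor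
  \<open>exp (- t\<^sup>2/(128 k))\<close>, where \<open>t\<close> is about \<open>k/\<mu>\<close>.
\<close>

section \<open>Positive semidefinite kernels\<close>

text \<open>Building the kernels as finite sums of rank one kernels, instead of demanding
  nonnegative quadratic forms, makes both the closure under products and the sign of the total sum
  plain inductions.\<close>

inductive gram :: "('a \<Rightarrow> 'a \<Rightarrow> real) \<Rightarrow> bool" where
  rank1: "gram (\<lambda>x y. \<phi> x * \<phi> y)"
| add: "gram K \<Longrightarrow> gram L \<Longrightarrow> gram (\<lambda>x y. K x y + L x y)"

lemma gram_const: "0 \<le> c \<Longrightarrow> gram (\<lambda>x y. c)"
  using rank1[of "\<lambda>_. sqrt c"] by simp

text \<open>Schur product theorem: the product of the rank one kernels of \<phi> and \<psi> is the
  rank one kernel of their pointwise product, and multiplication distributes over sums.\<close>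

lemma gram_mult:
  assumes "gram K" "gram L"
  shows "gram (\<lambda>x y. K x y * L x y)"
  using assms(1)
proof induction
  case (rank1 \<phi>)
  show ?case
    using assms(2)
  proof induction
    case (rank1 \<psi>)
    then show ?case
      using gram.rank1[of "\<lambda>x. \<phi> x * \<psi> x"] by (simp add: mult_ac)
  next
    case (add K L)
    then show ?case
      using gram.add by (fastforce simp: distrib_left)
  qed
next
  case (add K L)
  then show ?case
    using gram.add by (fastforce simp: distrib_right)
qed

lemma gram_scale: "0 \<le> c \<Longrightarrow> gram K \<Longrightarrow> gram (\<lambda>x y. c * K x y)"
  by (rule gram_mult[OF gram_const])

lemma gram_sum: "finite I \<Longrightarrow> (\<And>i. i \<in> I \<Longrightarrow> gram (K i)) \<Longrightarrow> gram (\<lambda>x y. \<Sum>i\<in>I. K i x y)"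
  by (induction I rule: finite_induct) (auto intro: gram_const gram.add)

lemma gram_prod: "finite I \<Longrightarrow> (\<And>i. i \<in> I \<Longrightarrow> gram (K i)) \<Longrightarrow> gram (\<lambda>x y. \<Prod>i\<in>I. K i x y)"
  by (induction I rule: finite_induct) (auto intro: gram_const gram_mult)

lemma gram_sum_nonneg: "gram K \<Longrightarrow> 0 \<le> (\<Sum>x\<in>X. \<Sum>y\<in>X. K x y)"
proof (induction rule: gram.induct)
  case (rank1 \<phi>)
  have "(\<Sum>x\<in>X. \<Sum>y\<in>X. \<phi> x * \<phi> y) = (\<Sum>x\<in>X. \<phi> x)\<^sup>2"
    by (simp add: power2_eq_square sum_product)
  then show ?case by simp
qed (simp add: sum.distrib)

section \<open>Polynomials with nonnegative coefficients applied to kernels\<close>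

inductive nonneg_poly :: "(real \<Rightarrow> real) \<Rightarrow> bool" where
  const: "0 \<le> c \<Longrightarrow> nonneg_poly (\<lambda>u. c)"
| id: "nonneg_poly (\<lambda>u. u)"
| add: "nonneg_poly f \<Longrightarrow> nonneg_poly g \<Longrightarrow> nonneg_poly (\<lambda>u. f u + g u)"
| mult: "nonneg_poly f \<Longrightarrow> nonneg_poly g \<Longrightarrow> nonneg_poly (\<lambda>u. f u * g u)"

lemma nonneg_poly_power: "nonneg_poly f \<Longrightarrow> nonneg_poly (\<lambda>u. f u ^ n)"
  by (induction n) (auto intro: nonneg_poly.intros)

lemma nonneg_poly_prod:
  "finite I \<Longrightarrow> (\<And>i. i \<in> I \<Longrightarrow> nonneg_poly (f i)) \<Longrightarrow> nonneg_poly (\<lambda>u. \<Prod>i\<in>I. f i u)"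
  by (induction I rule: finite_induct) (auto intro: nonneg_poly.intros)

text \<open>Up to a factor 2 these are the even and odd parts of \<open>f\<close>, which inherit
  nonnegative coefficients. They are treated together because the even part of a product mixes even
  * even with odd * odd, and the odd part the two mixed products. The odd part yields the factor
  \<open>h u - h (- u)\<close> later.\<close>

lemma gram_even_odd:
  assumes "nonneg_poly f" "gram K"
  shows "gram (\<lambda>x y. f (K x y) + f (- K x y)) \<and> gram (\<lambda>x y. f (K x y) - f (- K x y))"
  using assms(1)
proof induction
  case (const c)
  then show ?case by (auto intro: gram_const)
next
  case id
  have "gram (\<lambda>x y. 2 * K x y)" using assms(2) by (intro gram_scale) auto
  then show ?case by (auto intro: gram_const)
next
  case (add f g)
  have "gram (\<lambda>x y. (f (K x y) + f (- K x y)) + (g (K x y) + g (- K x y)))"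
    by (rule gram.add[OF conjunct1[OF add.IH(1)] conjunct1[OF add.IH(2)]])
  moreover have "gram (\<lambda>x y. (f (K x y) - f (- K x y)) + (g (K x y) - g (- K x y)))"
    by (rule gram.add[OF conjunct2[OF add.IH(1)] conjunct2[OF add.IH(2)]])
  ultimately show ?case by (simp add: algebra_simps)
next
  case (mult f g)
  let ?e = "\<lambda>f x y. f (K x y) + f (- K x y)" and ?o = "\<lambda>f x y. f (K x y) - f (- K x y)"
  note ef = conjunct1[OF mult.IH(1)] and eg = conjunct1[OF mult.IH(2)]
    and odf = conjunct2[OF mult.IH(1)] and og = conjunct2[OF mult.IH(2)]
  have "gram (\<lambda>x y. 1/2 * (?e f x y * ?e g x y + ?o f x y * ?o g x y))"
    by (rule gram_scale[OF _ gram.add[OF gram_mult[OF ef eg] gram_mult[OF odf og]]]) simp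
  moreover have "gram (\<lambda>x y. 1/2 * (?e f x y * ?o g x y + ?o f x y * ?e g x y))"
    by (rule gram_scale[OF _ gram.add[OF gram_mult[OF ef og] gram_mult[OF odf eg]]]) simp
  moreover have
    "(\<lambda>x y. 1/2 * (?e f x y * ?e g x y + ?o f x y * ?o g x y))
      = (\<lambda>x y. f (K x y) * g (K x y) + f (- K x y) * g (- K x y))"
    "(\<lambda>x y. 1/2 * (?e f x y * ?o g x y + ?o f x y * ?e g x y))
      = (\<lambda>x y. f (K x y) * g (K x y) - f (- K x y) * g (- K x y))"
    by (intro ext, simp add: field_simps)+
  ultimately show ?case by simp
qed

lemma gram_comp:
  assumes "nonneg_poly f" "gram K"
  shows "gram (\<lambda>x y. f (K x y))"
proof -
  have "gram (\<lambda>x y. 1/2 * ((f (K x y) + f (- K x y)) + (f (K x y) - f (- K x y))))"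
    using gram_even_odd[OF assms] by (intro gram_scale gram.add[of "\<lambda>x y. f (K x y) + f (- K x y)"]) auto
  then show ?thesis by simp
qed

section \<open>The weight polynomial h and its growth\<close>

text \<open>The zeros at \<open>- 2 ^ n\<close> damp the product along the negative axis at every
  dyadic scale up to \<open>2 ^ N\<close>. The even exponent keeps the product nonnegative on all
  reals, and the summand 1 keeps the weight at least 1, so that it may be divided by.\<close>

definition weight :: "nat \<Rightarrow> nat \<Rightarrow> real \<Rightarrow> real"
  where "weight m N u = 1 + (\<Prod>n\<le>N. (1 + u / 2 ^ n) ^ (2 * m))"

lemma nonneg_poly_weight: "nonneg_poly (weight m N)"
proof -
  have "nonneg_poly (\<lambda>u. 1 + (\<Prod>n\<in>{..N}. (1 + 1 / 2 ^ n * u) ^ (2 * m)))"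
    by (intro nonneg_poly.add nonneg_poly.const nonneg_poly_prod nonneg_poly_power
        nonneg_poly.mult nonneg_poly.id) auto
  then show ?thesis by (simp add: weight_def[abs_def])
qed

lemma weight_ge_1: "1 \<le> weight m N u"
  unfolding weight_def by (simp add: prod_nonneg power_mult)

lemma dyadic_bracket:
  assumes "1 \<le> (x::real)" "x \<le> 2 ^ N"
  shows "\<exists>n\<le>N. 2 ^ n \<le> x \<and> x \<le> 2 * 2 ^ n"
  using assms(2)
proof (induction N)
  case 0
  then show ?case using assms(1) by (auto intro!: exI[of _ 0])
next
  case (Suc N)
  show ?case
  proof (cases "x \<le> 2 ^ N")
    case True
    then show ?thesis using Suc.IH le_SucI by blast
  next
    case False
    then show ?thesis using Suc.prems by (intro exI[of _ N]) auto
  qed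
qed

text \<open>Each factor satisfies \<open>\<bar>1 - u\<bar> \<le> 1 + u\<close> for \<open>u \<ge> 0\<close>, and at every scale
  \<open>x\<close> some dyadic factor gains a factor \<open>3\<close> here.\<close>

lemma weight_separation:
  assumes x: "1 \<le> x" "x \<le> 2 ^ N" and m: "4 * real r + 2 \<le> 4 ^ m"
  shows "(2 * real r + 1) * weight m N (- x) \<le> weight m N x"
proof -
  let ?H = "\<lambda>u::real. \<Prod>n\<le>N. ((1 + u / 2 ^ n)\<^sup>2) ^ m"
  have wH: "weight m N u = 1 + ?H u" for u
    by (simp add: weight_def power_mult)
  obtain n where n: "n \<le> N" "2 ^ n \<le> x" "x \<le> 2 * 2 ^ n"
    using dyadic_bracket[OF x] by blast
  have Hrem: "?H u = ((1 + u / 2 ^ k)\<^sup>2) ^ m * (\<Prod>n\<in>{..N}-{k}. ((1 + u / 2 ^ n)\<^sup>2) ^ m)"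
    if "k \<le> N" for u k
    using that by (intro prod.remove) auto
  have sq: "(1 + - x / 2 ^ i)\<^sup>2 \<le> (1 + x / 2 ^ i)\<^sup>2" for i
    using x by (intro power2_le_iff_abs_le[THEN iffD2]) (auto simp: abs_le_iff)
  have u: "1 \<le> x / 2 ^ n" "x / 2 ^ n \<le> 2" using n by (auto simp: field_simps)
  \<comment> \<open>For w in [1, 2] the inequality 3 (w - 1) \<le> 1 + w holds, with equality at w =
    2.\<close>
  have "3 * \<bar>1 + - x / 2 ^ n\<bar> \<le> 1 + x / 2 ^ n" using u by (auto simp: abs_if)
  then have "(3 * \<bar>1 + - x / 2 ^ n\<bar>)\<^sup>2 \<le> (1 + x / 2 ^ n)\<^sup>2"
    by (intro power_mono) auto
  then have "9 * (1 + - x / 2 ^ n)\<^sup>2 \<le> (1 + x / 2 ^ n)\<^sup>2"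
    by (simp add: power_mult_distrib)
  then have a: "9 ^ m * ((1 + - x / 2 ^ n)\<^sup>2) ^ m \<le> ((1 + x / 2 ^ n)\<^sup>2) ^ m"
    using power_mono[of "9 * (1 + - x / 2 ^ n)\<^sup>2" "(1 + x / 2 ^ n)\<^sup>2" m]
    by (simp only: power_mult_distrib) (simp add: power_mult_distrib)
  have b: "(\<Prod>n\<in>{..N}-{n}. ((1 + - x / 2 ^ n)\<^sup>2) ^ m) \<le> (\<Prod>n\<in>{..N}-{n}. ((1 + x / 2 ^ n)\<^sup>2) ^ m)"
    using power_mono[OF sq] by (intro prod_mono conjI) auto
  have "9 ^ m * ?H (- x) \<le> ?H x"
    unfolding Hrem[OF n(1)] mult.assoc[symmetric]
    by (rule mult_mono[OF a b]) (auto intro!: prod_nonneg)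
  moreover have "(4::real) ^ m \<le> 9 ^ m" by (intro power_mono) auto
  moreover have H0: "0 \<le> ?H (- x)" by (intro prod_nonneg) auto
  ultimately have 1: "4 ^ m * ?H (- x) \<le> ?H x"
    by (meson mult_right_mono order_trans)
  have "(4 * real r + 2) * ?H (- x) \<le> ?H x"
    using mult_right_mono[OF m H0] 1 by linarith
  \<comment> \<open>Half of \<open>?H x\<close> has to dominate the summand 1 in
    \<open>weight m N (- x)\<close>, the other half \<open>?H (- x)\<close>; hence the constant
    \<open>4 * r + 2\<close> in place of \<open>2 * r + 1\<close>. For the former the factor n = 0
    suffices.\<close>
  moreover have "4 ^ m \<le> ?H x"
  proof -
    have "(2::real)\<^sup>2 \<le> (1 + x)\<^sup>2" using x by (intro power_mono) auto
    then have "(4::real) ^ m \<le> ((1 + x / 2 ^ 0)\<^sup>2) ^ m" by (intro power_mono) auto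
    moreover have "1 \<le> (\<Prod>n\<in>{..N}-{0}. ((1 + x / 2 ^ n)\<^sup>2) ^ m)"
      using x by (intro prod_ge_1) (auto intro!: one_le_power)
    ultimately have "4 ^ m * 1 \<le> ((1 + x / 2 ^ 0)\<^sup>2) ^ m * (\<Prod>n\<in>{..N}-{0}. ((1 + x / 2 ^ n)\<^sup>2) ^ m)"
      by (intro mult_mono) auto
    then show ?thesis using Hrem[of 0 x] by simp
  qed
  ultimately show ?thesis unfolding wH using m by (simp add: algebra_simps)
qed

lemma one_plus_power_le:
  fixes w :: real
  assumes "0 \<le> w" "0 < d"
  shows "1 + w ^ d \<le> (1 + w) ^ d"
proof -
  obtain n where n: "d = Suc n" using assms(2) gr0_conv_Suc by blast
  have "w * w ^ n \<le> w * (1 + w) ^ n"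
    using assms by (intro mult_left_mono power_mono) auto
  moreover have "1 \<le> (1 + w) ^ n" using assms by (intro one_le_power) auto
  ultimately show ?thesis by (simp add: n algebra_simps)
qed

text \<open>With \<open>q ^ d = 1/2\<close> each factor is at most a power of \<open>1 + (z * q ^ n)
  ^ d \<le> (1 + z * q ^ n) ^ d \<le> exp (d * z * q ^ n)\<close>, and the geometric series in
  \<open>q\<close> is at most \<open>2 * d\<close> by Bernoulli's inequality. The exponent is thus
  linear in \<open>z\<close> although the argument may be as large as \<open>z ^ d\<close>.\<close>

lemma weight_upper:
  assumes "\<bar>x\<bar> \<le> z ^ d" "0 \<le> z" "0 < d"
  shows "weight m N x \<le> 2 * exp (4 * real m * (real d)\<^sup>2 * z)"
proof -
  define q where "q = root d (1/2 :: real)"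
  have q: "q ^ d = 1/2" "0 \<le> q" unfolding q_def using assms(3) by auto
  have "q ^ d = 1 + real d * (- (1 / (2 * real d)))"
    using assms(3) q by simp
  also have "\<dots> \<le> (1 + - (1 / (2 * real d))) ^ d"
    using assms(3) by (intro Bernoulli_inequality) (auto simp: field_simps)
  finally have "q ^ d \<le> (1 - 1 / (2 * real d)) ^ d" by simp
  moreover have "0 \<le> 1 - 1 / (2 * real d)" using assms(3) by simp
  ultimately have qd: "q \<le> 1 - 1 / (2 * real d)"
    using power_mono_iff[of q "1 - 1 / (2 * real d)" d] assms(3) q(2) by blast
  moreover have "0 < 1 / (2 * real d)" using assms(3) by simp
  ultimately have q1: "q < 1" by linarith
  have "1 / (1 - q) \<le> 1 / (1 / (2 * real d))"
    using qd q1 assms(3) by (intro divide_left_mono mult_pos_pos) auto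
  then have q2: "1 / (1 - q) \<le> 2 * real d" by simp
  have qs: "(\<Sum>n\<le>N. q ^ n) \<le> 2 * real d"
  proof -
    have "(\<Sum>n\<le>N. q ^ n) \<le> (\<Sum>n. q ^ n)"
      using q q1 by (intro sum_le_suminf summable_geometric) auto
    then show ?thesis using q1 q2 q suminf_geometric[of q] by simp
  qed
  have fac: "(1 + x / 2 ^ n) ^ (2 * m) \<le> exp (2 * real m * real d * z * q ^ n)" for n
  proof -
    have "\<bar>1 + x / 2 ^ n\<bar> \<le> 1 + \<bar>x\<bar> / 2 ^ n"
      using abs_triangle_ineq[of 1 "x / 2 ^ n"] by simp
    also have "\<dots> \<le> 1 + z ^ d / 2 ^ n"
      using assms(1) by (auto intro: divide_right_mono)
    also have "\<dots> = 1 + (z * q ^ n) ^ d"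
      by (simp add: power_mult_distrib power_mult[symmetric] mult.commute[of n d])
        (simp add: power_mult q power_divide)
    also have "\<dots> \<le> (1 + z * q ^ n) ^ d"
      using assms q by (intro one_plus_power_le) auto
    also have "\<dots> \<le> exp (z * q ^ n) ^ d"
      using assms q by (intro power_mono exp_ge_add_one_self) auto
    finally have "\<bar>1 + x / 2 ^ n\<bar> ^ (2 * m) \<le> (exp (z * q ^ n) ^ d) ^ (2 * m)"
      by (intro power_mono) auto
    also have "\<dots> = exp (2 * real m * real d * z * q ^ n)"
      by (simp add: exp_of_nat_mult[symmetric] mult_ac)
    finally show ?thesis by (simp add: power_even_abs)
  qed
  have "(\<Prod>n\<le>N. (1 + x / 2 ^ n) ^ (2 * m)) \<le> (\<Prod>n\<le>N. exp (2 * real m * real d * z * q ^ n))"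
    using fac by (intro prod_mono) (auto simp: power_mult)
  also have "\<dots> = exp (2 * real m * real d * z * (\<Sum>n\<le>N. q ^ n))"
    by (simp add: exp_sum sum_distrib_left)
  also have "\<dots> \<le> exp (2 * real m * real d * z * (2 * real d))"
    unfolding exp_le_cancel_iff using qs assms by (intro mult_left_mono) auto
  also have "\<dots> = exp (4 * real m * (real d)\<^sup>2 * z)"
    by (simp add: power2_eq_square mult_ac)
  finally have "weight m N x \<le> 1 + exp (4 * real m * (real d)\<^sup>2 * z)"
    by (simp add: weight_def)
  moreover have "1 \<le> exp (4 * real m * (real d)\<^sup>2 * z)"
    using assms by simp
  ultimately show ?thesis by linarith
qed


section \<open>The averaged polynomial and the correlation bound\<close>

text \<open>Factoring out the full product, which is at least 1, leaves the sum of
  \<open>1 - h (- u j) / h (u j)\<close>. The term of \<open>k\<close> is at most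
  \<open>- 2 * r\<close> and every other term at most 1.\<close>

lemma weighted_sum_neg:
  fixes h :: "real \<Rightarrow> real" and u :: "nat \<Rightarrow> real"
  assumes h: "\<And>v. 1 \<le> h v"
    and k: "k < r" "(2 * real r + 1) * h (u k) \<le> h (- u k)"
  shows "(\<Sum>j<r. (h (u j) - h (- u j)) * (\<Prod>i\<in>{..<r}-{j}. h (u i))) \<le> - 1"
proof -
  have pos: "0 < h v" for v using h[of v] by linarith
  let ?P = "\<Prod>i<r. h (u i)" and ?\<phi> = "\<lambda>j. 1 - h (- u j) / h (u j)"
  have "(\<Sum>j<r. (h (u j) - h (- u j)) * (\<Prod>i\<in>{..<r}-{j}. h (u i))) = (\<Sum>j<r. ?P * ?\<phi> j)"
  proof (rule sum.cong)
    fix j assume "j \<in> {..<r}"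
    then have "?P = h (u j) * (\<Prod>i\<in>{..<r}-{j}. h (u i))" by (intro prod.remove) auto
    then show "(h (u j) - h (- u j)) * (\<Prod>i\<in>{..<r}-{j}. h (u i)) = ?P * ?\<phi> j"
      using pos[of "u j"] by (simp add: field_simps)
  qed simp
  also have "\<dots> = ?P * (\<Sum>j<r. ?\<phi> j)" by (simp add: sum_distrib_left)
  also have "\<dots> \<le> - 1"
  proof -
    have "(\<Sum>j<r. ?\<phi> j) = ?\<phi> k + (\<Sum>j\<in>{..<r}-{k}. ?\<phi> j)"
      using k by (intro sum.remove) auto
    also have "(\<Sum>j\<in>{..<r}-{k}. ?\<phi> j) \<le> (\<Sum>j\<in>{..<r}-{k}. 1)"
      using pos by (intro sum_mono) (auto simp: less_imp_le)
    also have "\<dots> \<le> real r" using k by simp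
    also have "?\<phi> k \<le> - 2 * real r" using k pos[of "u k"] by (simp add: field_simps)
    finally have "(\<Sum>j<r. ?\<phi> j) \<le> - 1" using k by linarith
    moreover have "1 \<le> ?P" using h by (intro prod_ge_1)
    ultimately have "?P * (\<Sum>j<r. ?\<phi> j) \<le> ?P * (- 1)" by (intro mult_left_mono) auto
    then show ?thesis using \<open>1 \<le> ?P\<close> by linarith
  qed
  finally show ?thesis .
qed

lemma weighted_sum_le:
  fixes h :: "real \<Rightarrow> real" and u :: "nat \<Rightarrow> real"
  assumes h: "\<And>v. 1 \<le> h v" and B: "\<And>i. i < r \<Longrightarrow> h (u i) \<le> B"
  shows "(\<Sum>j<r. (h (u j) - h (- u j)) * (\<Prod>i\<in>{..<r}-{j}. h (u i))) \<le> real r * B ^ r"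
proof -
  have pos: "0 \<le> h v" for v using h[of v] by linarith
  have "(h (u j) - h (- u j)) * (\<Prod>i\<in>{..<r}-{j}. h (u i)) \<le> B ^ r" if "j < r" for j
  proof -
    have "(h (u j) - h (- u j)) * (\<Prod>i\<in>{..<r}-{j}. h (u i)) \<le> h (u j) * (\<Prod>i\<in>{..<r}-{j}. h (u i))"
      using pos by (intro mult_right_mono prod_nonneg) auto
    also have "\<dots> = (\<Prod>i<r. h (u i))"
      using that by (intro prod.remove[symmetric]) auto
    also have "\<dots> \<le> (\<Prod>i<r. B)"
      using pos B by (intro prod_mono) auto
    finally show ?thesis by simp
  qed
  then have "(\<Sum>j<r. (h (u j) - h (- u j)) * (\<Prod>i\<in>{..<r}-{j}. h (u i))) \<le> (\<Sum>j<r. B ^ r)"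
    by (intro sum_mono) auto
  then show ?thesis by simp
qed

text \<open>Supplies the contradiction that ends \<open>gram_correlation\<close>. Each of the four
  factors 2, \<open>exp 1 * r\<close>, \<open>r + 1\<close> and \<open>2 ^ r\<close> is at most
  \<open>exp r\<close>, the first one strictly.\<close>

lemma exp_dominates: "1 \<le> r \<Longrightarrow> 2 * exp 1 * real r * (real r + 1) * 2 ^ r < exp (4 * real r)"
proof -
  assume r: "1 \<le> r"
  have e1: "real r \<le> exp (real r - 1)" using exp_ge_add_one_self[of "real r - 1"] by simp
  have e2: "real r + 1 \<le> exp (real r)" using exp_ge_add_one_self[of "real r"] by linarith
  have two: "(2::real) < exp 1" using exp_ge_add_one_self[of "1/2::real"]
    by (smt (verit, best) exp_gt_one exp_lower_Taylor_quadratic field_sum_of_halves one_power2)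
  have e3: "(2::real) ^ r \<le> exp (real r)"
    using power_mono[of 2 "exp 1 :: real" r] two by (simp add: exp_of_nat_mult[symmetric])
  have e4: "(2::real) < exp (real r)"
    using two r by (smt (verit) exp_le_cancel_iff of_nat_1 of_nat_le_iff)
  have "2 * (exp 1 * real r) * (real r + 1) * 2 ^ r
      < exp (real r) * (exp 1 * exp (real r - 1)) * exp (real r) * exp (real r)"
    using e1 e2 e3 e4 r
    by (intro mult_less_le_imp_less mult_mono mult_nonneg_nonneg mult_pos_pos) auto
  also have "\<dots> = exp (4 * real r)" by (simp add: exp_add[symmetric])
  finally show ?thesis by (simp add: mult_ac)
qed

text \<open>The sum of \<open>F\<close> over all pairs is nonnegative, so \<open>F + 1\<close> sums
  to at least the number of pairs. Pairs with a correlation below -1 contribute nothing positive, so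
  the good pairs carry the whole sum. If all the counts were too small, slicing the good pairs by
  their largest correlation would bound that sum by less.\<close>

lemma gram_correlation:
  fixes K :: "nat \<Rightarrow> 'a \<Rightarrow> 'a \<Rightarrow> real"
  assumes X: "finite X" "X \<noteq> {}" and r: "1 \<le> r" and d: "1 \<le> d"
    and m: "4 * real r + 2 \<le> 4 ^ m" and K: "\<And>i. i < r \<Longrightarrow> gram (K i)"
  shows "\<exists>i<r. \<exists>z\<ge>1. exp (- (12 * real m * real r * (real d)\<^sup>2 * z)) * (real (card X))\<^sup>2
    \<le> real (card {(x, y) \<in> X \<times> X. z ^ d - 2 \<le> K i x y \<and> (\<forall>j<r. - 1 \<le> K j x y)})"
proof (rule ccontr)
  define S where "S i z = {(x, y) \<in> X \<times> X. z ^ d - 2 \<le> K i x y \<and> (\<forall>j<r. - 1 \<le> K j x y)}"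
    for i and z :: real
  \<comment> \<open>By \<open>weight_upper\<close> a product over all \<open>r\<close> colours grows
    like \<open>exp (E * y)\<close>, while the assumed tails decay like
    \<open>exp (- 3 * E * z)\<close>. Of the surplus, one factor \<open>exp (- E)\<close> beats the
    constants and the other makes the series over slices converge.\<close>
  define E where "E = 4 * m * r * d\<^sup>2"
  assume neg: "\<not> ?thesis"
  then have contra: "real (card (S i z)) < exp (- (3 * real E * z)) * (real (card X))\<^sup>2"
    if "i < r" "1 \<le> z" for i z
  proof -
    have "3 * real E * z = 12 * real m * real r * (real d)\<^sup>2 * z" by (simp add: E_def)
    moreover have "\<not> exp (- (12 * real m * real r * (real d)\<^sup>2 * z)) * (real (card X))\<^sup>2
        \<le> real (card (S i z))"
      using neg that unfolding S_def by blast
    ultimately show ?thesis by (simp only: not_le)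
  qed
  have "m \<noteq> 0" using m r by (intro notI) auto
  then have E: "4 * r \<le> E" using d by (auto simp: E_def)
  \<comment> \<open>Finiteness of \<open>X\<close> gives one truncation level at which
    \<open>weight_separation\<close> covers every correlation below -1.\<close>
  obtain N where N: "\<bar>K i x y\<bar> \<le> 2 ^ N" if "i < r" "x \<in> X" "y \<in> X" for i x y
  proof -
    let ?K = "\<lambda>(i, x, y). \<bar>K i x y\<bar>"
    define s where "s = sum ?K ({..<r} \<times> X \<times> X)"
    obtain N where N: "s < 2 ^ N" using real_arch_pow[of 2 s] by auto
    have "\<bar>K i x y\<bar> \<le> 2 ^ N" if "i < r" "x \<in> X" "y \<in> X" for i x y
    proof -
      have "?K (i, x, y) \<le> s"
        unfolding s_def by (rule member_le_sum) (use that X in auto)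
      then show ?thesis using N by simp
    qed
    then show ?thesis using that by blast
  qed
  define h where "h = weight m N"
  have h1: "1 \<le> h v" for v unfolding h_def by (rule weight_ge_1)
  define F where "F x y = (\<Sum>j<r. (h (K j x y) - h (- K j x y)) * (\<Prod>i\<in>{..<r}-{j}. h (K i x y)))"
    for x y
  have np: "nonneg_poly h" unfolding h_def by (rule nonneg_poly_weight)
  have "gram F"
    unfolding F_def[abs_def]
  proof (rule gram_sum)
    fix j assume "j \<in> {..<r}"
    then have j: "gram (K j)" using K by simp
    have "gram (\<lambda>x y. \<Prod>i\<in>{..<r}-{j}. h (K i x y))"
      by (rule gram_prod) (auto intro!: gram_comp[OF np K])
    then show "gram (\<lambda>x y. (h (K j x y) - h (- K j x y)) * (\<Prod>i\<in>{..<r}-{j}. h (K i x y)))"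
      by (rule gram_mult[OF conjunct2[OF gram_even_odd[OF np j]]])
  qed simp
  then have F0: "0 \<le> (\<Sum>p\<in>X \<times> X. F (fst p) (snd p))"
    using gram_sum_nonneg[of F X] by (simp add: sum.cartesian_product case_prod_beta)
  define Kp where "Kp j p = K j (fst p) (snd p)" for j p
  define G where "G = {p \<in> X \<times> X. \<forall>j<r. - 1 \<le> Kp j p}"
  \<comment> \<open>\<open>Z p\<close> is the largest correlation of the pair. Adding 2 makes
    \<open>y p\<close> at least 1 on \<open>G\<close>, where \<open>Z p\<close> may be as low as -1,
    and produces the \<open>z ^ d - 2\<close> of the claim.\<close>
  define Z where "Z p = Max ((\<lambda>j. Kp j p) ` {..<r})" for p
  define y where "y p = root d (Z p + 2)" for p
  define n where "n p = nat \<lfloor>real E * y p\<rfloor>" for p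
  have fin: "finite (X \<times> X)" "finite G" using X by (auto simp: G_def)
  have Zge: "Kp j p \<le> Z p" if "j < r" for j p using that by (auto simp: Z_def)
  have Zat: "\<exists>j<r. Kp j p = Z p" for p
  proof -
    have "Z p \<in> (\<lambda>j. Kp j p) ` {..<r}" unfolding Z_def using r by (intro Max_in) (auto simp: lessThan_empty_iff)
    then show ?thesis by auto
  qed
  have y1: "1 \<le> y p" "y p ^ d = Z p + 2" if "p \<in> G" for p
  proof -
    have "- 1 \<le> Z p" using Zat[of p] that by (auto simp: G_def)
    then show "1 \<le> y p" "y p ^ d = Z p + 2" using d unfolding y_def by auto
  qed
  have n: "real (n p) \<le> real E * y p" "real E * y p \<le> real (n p) + 1" "real E \<le> real (n p)" 
    if "p \<in> G" for p
  proof -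
    have "real E * 1 \<le> real E * y p" using y1(1)[OF that] by (intro mult_left_mono) auto
    then have 1: "real E \<le> real E * y p" by simp
    then have "E \<le> n p" unfolding n_def by (rule le_nat_floor)
    then show "real E \<le> real (n p)" by simp
    have "0 \<le> real E * y p" using 1 by (rule order_trans[rotated]) simp
    then show "real (n p) \<le> real E * y p" "real E * y p \<le> real (n p) + 1"
      unfolding n_def by linarith+
  qed
  \<comment> \<open>\<open>r + 1\<close> in place of \<open>r\<close> absorbs the 1 added to
    \<open>F\<close>, and \<open>exp 1\<close> the rounding of \<open>E * y p\<close> down to
    \<open>n p\<close>.\<close>
  define A where "A = (real r + 1) * 2 ^ r * exp 1"
  have good: "F (fst p) (snd p) + 1 \<le> A * exp (real (n p))" if p: "p \<in> G" for p
  proof -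
    have "h (Kp i p) \<le> 2 * exp (4 * real m * (real d)\<^sup>2 * y p)" if "i < r" for i
    proof -
      have "\<bar>Kp i p\<bar> \<le> y p ^ d" using Zge[OF that, of p] p that y1(1,2)[OF p] 
        by (auto simp: G_def abs_le_iff)
      then show ?thesis unfolding h_def using y1(1)[OF p] d by (intro weight_upper) auto
    qed
    then have "F (fst p) (snd p) \<le> real r * (2 * exp (4 * real m * (real d)\<^sup>2 * y p)) ^ r"
      unfolding F_def Kp_def by (intro weighted_sum_le h1)
    also have "\<dots> = real r * 2 ^ r * exp (real E * y p)"
      by (simp add: power_mult_distrib exp_of_nat_mult[symmetric] E_def mult_ac)
    also have "\<dots> \<le> real r * 2 ^ r * exp (real (n p) + 1)"
      using n[OF p] by (intro mult_left_mono) auto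
    finally have "F (fst p) (snd p) \<le> real r * 2 ^ r * exp (real (n p) + 1)" .
    moreover have "1 * 1 \<le> 2 ^ r * exp (real (n p) + 1)" by (intro mult_mono) auto
    ultimately show ?thesis by (simp add: A_def exp_add algebra_simps)
  qed
  have bad: "F (fst p) (snd p) + 1 \<le> 0" if p: "p \<in> X \<times> X - G" for p
  proof -
    obtain k where k: "k < r" "Kp k p < - 1" using p by (auto simp: G_def not_le)
    have "(2 * real r + 1) * h (- (- Kp k p)) \<le> h (- Kp k p)"
      unfolding h_def using k N[of k "fst p" "snd p"] p m
      by (intro weight_separation) (auto simp: Kp_def)
    then show ?thesis
      using weighted_sum_neg[where h = h and u = "\<lambda>i. Kp i p", OF h1 k(1)] by (simp add: F_def Kp_def)
  qed
  have cn: "real (card {p \<in> G. n p = q}) \<le> real r * exp (- 3 * real q) * (real (card X))\<^sup>2"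
    if q: "q \<in> n ` G" for q
  proof -
    define z where "z = real q / real E"
    have E0: "0 < real E" using E r by simp
    have "real E \<le> real q" using q n by auto
    then have z1: "1 \<le> z" using E0 by (simp add: z_def)
    have "{p \<in> G. n p = q} \<subseteq> (\<Union>i<r. S i z)"
    proof
      fix p assume "p \<in> {p \<in> G. n p = q}"
      then have p: "p \<in> G" "n p = q" by auto
      obtain j where j: "j < r" "Kp j p = Z p" using Zat by blast
      have "z \<le> y p" using n(1)[OF p(1)] p(2) E0 by (simp add: z_def field_simps)
      then have "z ^ d \<le> y p ^ d" using z1 by (intro power_mono) auto
      then have "p \<in> S j z" using y1(2)[OF p(1)] p j by (auto simp: S_def G_def Kp_def)
      then show "p \<in> (\<Union>i<r. S i z)" using j by auto
    qed
    moreover have finS: "finite (S i z)" for i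
      by (rule finite_subset[OF _ fin(1)]) (auto simp: S_def)
    ultimately have "card {p \<in> G. n p = q} \<le> card (\<Union>i<r. S i z)" by (intro card_mono) auto
    also have "\<dots> \<le> (\<Sum>i<r. card (S i z))" by (intro card_UN_le) auto
    finally have "real (card {p \<in> G. n p = q}) \<le> (\<Sum>i<r. real (card (S i z)))"
      by (metis of_nat_le_iff of_nat_sum)
    also have "\<dots> \<le> (\<Sum>i<r. exp (- (3 * real E * z)) * (real (card X))\<^sup>2)"
      using contra z1 by (intro sum_mono) (auto simp: less_imp_le)
    finally show ?thesis using E0 by (simp add: z_def)
  qed
  have geo: "(\<Sum>q\<in>n ` G. exp (- real q)) \<le> 2"
  proof -
    have 2: "exp (-1) \<le> (1/2 :: real)"
      using exp_ge_add_one_self[of "1::real"] by (simp add: exp_minus field_simps)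
    have "(\<Sum>q\<in>n ` G. exp (- real q)) = (\<Sum>q\<in>n ` G. exp (- 1 :: real) ^ q)"
      by (simp add: exp_of_nat_mult[symmetric])
    also have "\<dots> \<le> (\<Sum>q\<in>n ` G. (1/2) ^ q)"
      using 2 by (intro sum_mono power_mono) auto
    also have "\<dots> \<le> (\<Sum>q. (1/2) ^ q)"
      using fin by (intro sum_le_suminf summable_geometric) auto
    also have "\<dots> = 2" by (simp add: suminf_geometric)
    finally show ?thesis .
  qed
  define M where "M = (real (card X))\<^sup>2"
  have M: "0 < M" using X by (simp add: M_def card_gt_0_iff)
  have A: "0 \<le> A" by (simp add: A_def)
  have "M \<le> (\<Sum>p\<in>X \<times> X. F (fst p) (snd p) + 1)"
    using F0 by (simp add: sum.distrib M_def card_cartesian_product power2_eq_square)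
  also have "\<dots> = (\<Sum>p\<in>G. F (fst p) (snd p) + 1) + (\<Sum>p\<in>X \<times> X - G. F (fst p) (snd p) + 1)"
    using fin by (subst sum.subset_diff[of G]) (auto simp: G_def)
  also have "\<dots> \<le> (\<Sum>p\<in>G. A * exp (real (n p))) + 0"
    using good bad by (intro add_mono sum_mono sum_nonpos) auto
  also have "\<dots> = A * (\<Sum>p\<in>G. exp (real (n p)))" by (simp add: sum_distrib_left)
  also have "(\<Sum>p\<in>G. exp (real (n p))) = (\<Sum>q\<in>n ` G. \<Sum>p\<in>{p\<in>G. n p = q}. exp (real (n p)))"
    by (rule sum.image_gen[OF fin(2)])
  also have "\<dots> = (\<Sum>q\<in>n ` G. real (card {p\<in>G. n p = q}) * exp (real q))" by simp
  also have "\<dots> \<le> (\<Sum>q\<in>n ` G. real r * M * exp (- real E) * exp (- real q))"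
  proof (rule sum_mono)
    fix q assume q: "q \<in> n ` G"
    have "real E \<le> real q" using q n by auto
    have "real (card {p\<in>G. n p = q}) * exp (real q) \<le> real r * exp (- 3 * real q) * M * exp (real q)"
      using cn[OF q] by (intro mult_right_mono) (auto simp: M_def)
    also have "\<dots> = real r * M * (exp (- real q) * exp (- real q))"
      by (simp add: exp_add[symmetric] mult_ac)
    also have "\<dots> \<le> real r * M * (exp (- real E) * exp (- real q))"
      using \<open>real E \<le> real q\<close> M by (intro mult_left_mono mult_right_mono) auto
    finally show "real (card {p\<in>G. n p = q}) * exp (real q) \<le> real r * M * exp (- real E) * exp (- real q)"
      by (simp add: mult_ac)
  qed
  also have "\<dots> = real r * M * exp (- real E) * (\<Sum>q\<in>n ` G. exp (- real q))"
    by (simp add: sum_distrib_left)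
  also have "\<dots> \<le> real r * M * exp (- real E) * 2"
    using geo M by (intro mult_left_mono) auto
  finally have "M \<le> A * (real r * M * exp (- real E) * 2)" using A by (simp add: mult_left_mono)
  also have "\<dots> = M * (2 * exp 1 * real r * (real r + 1) * 2 ^ r * exp (- real E))"
    by (simp add: A_def mult_ac)
  finally have "1 \<le> 2 * exp 1 * real r * (real r + 1) * 2 ^ r * exp (- real E)"
    using M by simp
  also have "\<dots> < exp (4 * real r) * exp (- real E)"
    using exp_dominates[OF r] by (intro mult_strict_right_mono) auto
  also have "\<dots> \<le> 1" using E by (simp add: exp_add[symmetric])
  finally show False by simp
qed

section \<open>The key lemma\<close>

text \<open>A total symmetric function encodes the colouring; \<open>nb\<close> and
  \<open>clique_free\<close> read it at distinct vertices only.\<close>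

locale edge_coloring =
  fixes col :: "'a \<Rightarrow> 'a \<Rightarrow> nat" and r :: nat
  assumes col_sym: "col x y = col y x" and col_less: "col x y < r"
begin

definition nb :: "nat \<Rightarrow> 'a \<Rightarrow> 'a set \<Rightarrow> 'a set"
  where "nb i v S = {u \<in> S. u \<noteq> v \<and> col v u = i}"

definition clique_free :: "nat \<Rightarrow> 'a set \<Rightarrow> nat \<Rightarrow> bool"
  where "clique_free i A a \<longleftrightarrow>
    \<not> (\<exists>S\<subseteq>A. finite S \<and> card S = a \<and> (\<forall>x\<in>S. \<forall>y\<in>S. x \<noteq> y \<longrightarrow> col x y = i))"

lemma r_pos: "0 < r"
  using col_less[of undefined undefined] by simp

lemma nb_subset: "nb i v S \<subseteq> S"
  by (auto simp: nb_def)

lemma finite_nb: "finite S \<Longrightarrow> finite (nb i v S)"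
  by (rule finite_subset[OF nb_subset])

lemma clique_free_subset: "clique_free i A a \<Longrightarrow> B \<subseteq> A \<Longrightarrow> clique_free i B a"
  unfolding clique_free_def by blast

lemma not_clique_free_0: "\<not> clique_free i A 0"
  unfolding clique_free_def by (auto intro!: exI[of _ "{}"])

lemma clique_free_nb:
  assumes "clique_free i A (Suc a)" "v \<in> A"
  shows "clique_free i (nb i v A) a"
  unfolding clique_free_def
proof (rule notI, elim exE conjE)
  fix S assume S: "S \<subseteq> nb i v A" "finite S" "card S = a" "\<forall>x\<in>S. \<forall>y\<in>S. x \<noteq> y \<longrightarrow> col x y = i"
  have "v \<notin> S" using S by (auto simp: nb_def)
  then have "card (insert v S) = Suc a" using S by simp
  moreover have "insert v S \<subseteq> A" using S assms(2) by (auto simp: nb_def)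
  moreover have "\<forall>x\<in>insert v S. \<forall>y\<in>insert v S. x \<noteq> y \<longrightarrow> col x y = i"
    using S col_sym by (fastforce simp: nb_def subset_iff)
  ultimately show False
    using assms(1) S(2) unfolding clique_free_def by (meson finite_insert)
qed

lemma sum_card_nb:
  assumes "finite S"
  shows "(\<Sum>i<r. card (nb i v S)) = card (S - {v})"
proof -
  have "S - {v} = (\<Union>i\<in>{..<r}. nb i v S)" using col_less by (auto simp: nb_def)
  moreover have "card (\<Union>i\<in>{..<r}. nb i v S) = (\<Sum>i<r. card (nb i v S))"
    by (rule card_UN_disjoint) (auto simp: assms finite_nb nb_def)
  ultimately show ?thesis by simp
qed

text \<open>Each neighbourhood \<open>nb i x (Y i)\<close> is trimmed to a set \<open>T i x\<close>
  of exactly \<open>\<kappa> i\<close> vertices. The covariances of the indicators of these sets are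
  Gram kernels, so \<open>gram_correlation\<close> finds many positively correlated pairs, and
  averaging fixes their first vertex \<open>x\<close>. Then \<open>X'\<close> consists of its
  partners and \<open>Y' i\<close> is \<open>T i x\<close>.\<close>

lemma key_lemma:
  fixes p :: "nat \<Rightarrow> real"
  assumes X: "finite X" "X \<noteq> {}" and d: "1 \<le> d" and m: "4 * real r + 2 \<le> 4 ^ m"
    and Y: "\<And>i. i < r \<Longrightarrow> finite (Y i)"
    and \<kappa>: "\<And>i x. i < r \<Longrightarrow> x \<in> X \<Longrightarrow> \<kappa> i \<le> card (nb i x (Y i))" "\<And>i. i < r \<Longrightarrow> 0 < \<kappa> i"
    and \<alpha>: "\<And>i. i < r \<Longrightarrow> 0 < \<alpha> i"
    and p: "\<And>i. i < r \<Longrightarrow> p i * card (Y i) = \<kappa> i"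
  obtains x l z X' Y' where "x \<in> X" "l < r" "1 \<le> z" "X' \<subseteq> X"
    "exp (- (12 * real m * real r * (real d)\<^sup>2 * z)) * card X \<le> card X'"
    "\<And>i. i < r \<Longrightarrow> Y' i \<subseteq> nb i x (Y i)" "\<And>i. i < r \<Longrightarrow> card (Y' i) = \<kappa> i"
    "\<And>i y. i < r \<Longrightarrow> y \<in> X' \<Longrightarrow> (p i - \<alpha> i) * \<kappa> i \<le> card (nb i y (Y' i))"
    "\<And>y. y \<in> X' \<Longrightarrow> (p l + (z ^ d - 2) * \<alpha> l) * \<kappa> l \<le> card (nb l y (Y' l))"
proof -
  have "\<exists>T. T \<subseteq> nb i x (Y i) \<and> card T = \<kappa> i" if "i < r" "x \<in> X" for i x
    using obtain_subset_with_card_n[OF \<kappa>(1)[OF that]] by metis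
  then obtain T where T: "T i x \<subseteq> nb i x (Y i)" "card (T i x) = \<kappa> i" if "i < r" "x \<in> X" for i x
    by metis
  have finT: "finite (T i x)" if "i < r" "x \<in> X" for i x
    using T[OF that] finite_nb[OF Y[OF that(1)]] finite_subset by blast
  \<comment> \<open>Centring at \<open>p i\<close> gives one rank one kernel per vertex of
    \<open>Y i\<close>. As all \<open>T i x\<close> have size \<open>p i * card (Y i)\<close>, the
    covariance reduces to the excess of the intersection over its expected size; the unit is
    \<open>\<alpha> i * \<kappa> i\<close>.\<close>
  define K where "K i x y = 1 / (\<alpha> i * \<kappa> i) *
    (\<Sum>v\<in>Y i. (indicator (T i x) v - p i) * (indicator (T i y) v - p i))" for i x y
  have gram: "gram (K i)" if "i < r" for i
    unfolding K_def[abs_def] using that \<alpha>[OF that]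
    by (intro gram_scale gram_sum gram.rank1 Y) auto
  have K: "K i x y = (card (T i x \<inter> T i y) - p i * \<kappa> i) / (\<alpha> i * \<kappa> i)"
    if i: "i < r" and x: "x \<in> X" and y: "y \<in> X" for i x y
  proof -
    have ind: "(\<Sum>v\<in>Y i. indicator S v) = real (card S)" if "S \<subseteq> Y i" for S
      using that Y[OF i] by (simp add: indicator_def of_bool_def sum.If_cases Int_absorb1 Int_absorb2)
    have sub: "T i x \<subseteq> Y i" "T i y \<subseteq> Y i" "T i x \<inter> T i y \<subseteq> Y i"
      using T i x y nb_subset by blast+
    have "(\<Sum>v\<in>Y i. (indicator (T i x) v - p i) * (indicator (T i y) v - p i))
      = (\<Sum>v\<in>Y i. indicator (T i x \<inter> T i y) v - p i * indicator (T i x) v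
            - p i * indicator (T i y) v + p i * p i)"
      by (intro sum.cong refl) (simp add: indicator_inter_arith algebra_simps)
    also have "\<dots> = card (T i x \<inter> T i y) - p i * \<kappa> i - p i * \<kappa> i + card (Y i) * (p i * p i)"
      using sub T i x y
      by (simp add: sum.distrib sum_subtractf sum_distrib_left[symmetric] ind)
    also have "card (Y i) * (p i * p i) = p i * \<kappa> i" by (simp add: p[OF i, symmetric] mult_ac)
    finally show ?thesis by (simp add: K_def)
  qed
  have K_ge: "s \<le> K i x y \<Longrightarrow> (p i + s * \<alpha> i) * \<kappa> i \<le> card (nb i y (T i x))"
    if i: "i < r" and x: "x \<in> X" and y: "y \<in> X" for i x y s
  proof -
    assume "s \<le> K i x y"
    then have "(p i + s * \<alpha> i) * \<kappa> i \<le> card (T i x \<inter> T i y)"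
      using K[OF i x y] \<alpha>[OF i] \<kappa>(2)[OF i] by (simp add: pos_le_divide_eq algebra_simps)
    moreover have "card (T i x \<inter> T i y) \<le> card (nb i y (T i x))"
      using T(1)[OF i y] finT[OF i x] by (intro card_mono finite_nb) (auto simp: nb_def)
    ultimately show ?thesis by linarith
  qed
  let ?c = "\<lambda>z. exp (- (12 * real m * real r * (real d)\<^sup>2 * z))"
  obtain l z where l: "l < r" and z: "1 \<le> z" and count: "?c z * (real (card X))\<^sup>2
      \<le> card {(x, y) \<in> X \<times> X. z ^ d - 2 \<le> K l x y \<and> (\<forall>j<r. - 1 \<le> K j x y)}"
    using gram_correlation[where K = K, OF X _ d m gram] r_pos
    by (auto simp: Suc_le_eq)
  define G where "G x = {y \<in> X. z ^ d - 2 \<le> K l x y \<and> (\<forall>j<r. - 1 \<le> K j x y)}" for x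
  have "{(x, y) \<in> X \<times> X. z ^ d - 2 \<le> K l x y \<and> (\<forall>j<r. - 1 \<le> K j x y)} = (SIGMA x:X. G x)"
    by (auto simp: G_def)
  then have "?c z * (real (card X))\<^sup>2 \<le> (\<Sum>x\<in>X. card (G x))"
    using count X by (simp add: G_def)
  then obtain x where x: "x \<in> X" "?c z * card X \<le> card (G x)"
  proof -
    have "\<exists>x\<in>X. ?c z * card X \<le> card (G x)"
    proof (rule ccontr)
      assume "\<not> ?thesis"
      then have "(\<Sum>x\<in>X. real (card (G x))) < (\<Sum>x\<in>X. ?c z * card X)"
        using X by (intro sum_strict_mono) (auto simp: not_le)
      then show False
        using \<open>?c z * (real (card X))\<^sup>2 \<le> (\<Sum>x\<in>X. card (G x))\<close>
        by (simp add: power2_eq_square mult_ac)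
    qed
    then show ?thesis using that by blast
  qed
  show ?thesis
  proof (rule that[OF x(1) l z _ x(2), of "\<lambda>i. T i x"])
    fix i y assume "i < r" "y \<in> G x"
    then show "(p i - \<alpha> i) * \<kappa> i \<le> card (nb i y (T i x))"
      using K_ge[of i x y "- 1"] x(1) by (auto simp: G_def)
  next
    fix y assume "y \<in> G x"
    then show "(p l + (z ^ d - 2) * \<alpha> l) * \<kappa> l \<le> card (nb l y (T l x))"
      using K_ge[of l x y] x(1) l by (auto simp: G_def)
  qed (use T x in \<open>auto simp: G_def\<close>)
qed

end

section \<open>The book algorithm\<close>

text \<open>Both replaced terms are added, not subtracted, so that the rule serves sums of naturals
  as well as of reals.\<close>

lemma sum_fun_upd:
  fixes F :: "'i \<Rightarrow> 'v \<Rightarrow> 'm::comm_monoid_add"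
  assumes "finite I" "j \<in> I"
  shows "(\<Sum>i\<in>I. F i ((a(j := v)) i)) + F j (a j) = (\<Sum>i\<in>I. F i (a i)) + F j v"
proof -
  have "(\<Sum>i\<in>I - {j}. F i ((a(j := v)) i)) = (\<Sum>i\<in>I - {j}. F i (a i))"
    by (intro sum.cong) auto
  then show ?thesis
    using sum.remove[OF assms, of "\<lambda>i. F i (a i)"] sum.remove[OF assms, of "\<lambda>i. F i ((a(j := v)) i)"]
    by (simp add: ac_simps)
qed

lemma neg_ln_one_minus_inverse:
  fixes t :: real
  assumes "2 \<le> t"
  shows "- ln (1 - 1 / t) \<le> 2 / t"
proof -
  have "ln (1 / (1 - 1 / t)) \<le> 1 / (1 - 1 / t) - 1" using assms by (intro ln_le_minus_one) auto
  moreover have "1 / (1 - 1 / t) - 1 \<le> 2 / t" using assms by (simp add: field_simps)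
  moreover have "ln (1 / (1 - 1 / t)) = - ln (1 - 1 / t)" using assms by (simp add: ln_div)
  ultimately show ?thesis by linarith
qed

context edge_coloring
begin

text \<open>
  Invariants: colour \<open>i\<close> still needs \<open>n i\<close> vertices, and every vertex of \<open>X\<close> has density at least
  \<open>P + a i\<close> into \<open>Y i\<close>. A colour step multiplies \<open>a j\<close> by \<open>1 - 1 / t\<close>; a density boost multiplies
  \<open>a l\<close> by \<open>1 + (z ^ d - 2) / t\<close>, so \<open>- ln (a l)\<close> pays for the vertices lost in the boost.
\<close>

lemma book:
  fixes P \<delta> A B D Q M t z\<^sub>0 :: real and X :: "'a set" and Y :: "nat \<Rightarrow> 'a set"
    and a :: "nat \<Rightarrow> real" and b n :: "nat \<Rightarrow> nat" and d m :: nat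
  defines "C \<equiv> 12 * real m * real r * (real d)\<^sup>2"
  assumes d: "1 \<le> d" and m: "4 * real r + 2 \<le> 4 ^ m"
    and par: "0 < P" "2 \<le> t" "0 < \<delta>" "0 \<le> D" "0 \<le> B" "0 \<le> z\<^sub>0" "2 \<le> z\<^sub>0 ^ d"
    and A: "ln (2 * real r) + C * z\<^sub>0 + 2 * B / t \<le> A"
    and boostX: "\<And>z. z\<^sub>0 < z \<Longrightarrow> z ^ d - 2 \<le> t / \<delta> \<Longrightarrow> C * z \<le> B * ln (1 + (z ^ d - 2) / t)"
    and boostY: "\<And>z. z\<^sub>0 < z \<Longrightarrow> - ln P \<le> D * ln (1 + (z ^ d - 2) / t)"
    and Q: "- ln P + 2 * D / t \<le> Q"
    and fin: "finite X" "X \<noteq> {}" "\<And>i. i < r \<Longrightarrow> finite (Y i)" "\<And>i. i < r \<Longrightarrow> Y i \<noteq> {}"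
    and deg: "\<And>i x. i < r \<Longrightarrow> x \<in> X \<Longrightarrow> (P + a i) * card (Y i) \<le> card (nb i x (Y i))"
    and a: "\<And>i. i < r \<Longrightarrow> \<delta> \<le> a i * (1 - 1 / t) ^ n i"
    and bigX: "A * (\<Sum>i<r. real (n i)) - B * (\<Sum>i<r. ln (a i)) \<le> ln (card X)"
    and bigY: "\<And>i. i < r \<Longrightarrow> n i * Q - D * ln (a i) + M \<le> ln (card (Y i))"
    and free: "\<And>i. i < r \<Longrightarrow> clique_free i (X \<union> Y i) (b i + n i)"
  shows "\<exists>j<r. \<exists>Y'\<subseteq>Y j. Y' \<noteq> {} \<and> clique_free j Y' (b j) \<and> M \<le> ln (card Y')"
  using fin deg a bigX bigY free
\<comment> \<open>A colour step lowers the sum of the \<open>n i\<close> and enlarges no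
  \<open>Y i\<close>; a boost keeps every \<open>n i\<close> and strictly shrinks
  \<open>Y l\<close>.\<close>
proof (induction "(\<Sum>i<r. n i) + (\<Sum>i<r. card (Y i))" arbitrary: X Y n a rule: less_induct)
  case less
  note fin = less.prems(1-4) and deg = less.prems(5) and a = less.prems(6)
    and bigX = less.prems(7) and bigY = less.prems(8) and free = less.prems(9)
  have cardY: "0 < card (Y i)" if "i < r" for i using fin that by (simp add: card_gt_0_iff)
  have cardX: "0 < card X" using fin by (simp add: card_gt_0_iff)
  have t1: "0 < 1 - 1 / t" "1 - 1 / t \<le> 1" using par by auto
  obtain x0 where x0: "x0 \<in> X" using fin by blast
  have apos: "\<delta> \<le> a i" "0 < a i" if "i < r" for i
  proof -
    have ge: "\<delta> \<le> a i * (1 - 1 / t) ^ n i" by (rule a[OF that])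
    then have "0 < a i" using par t1
      by (meson less_le_trans zero_less_mult_pos2 zero_less_power)
    moreover have "(1 - 1 / t) ^ n i \<le> 1" using t1 by (intro power_le_one) auto
    ultimately have "a i * (1 - 1 / t) ^ n i \<le> a i" by (simp add: mult_left_le)
    then show "\<delta> \<le> a i" "0 < a i" using ge \<open>0 < a i\<close> by linarith+
  qed
  have A0: "0 \<le> A" "0 \<le> C"
  proof -
    show "0 \<le> C" by (simp add: C_def)
    moreover have "0 \<le> ln (2 * real r)" using r_pos by simp
    ultimately show "0 \<le> A" using A par by (smt (verit) divide_nonneg_nonneg mult_nonneg_nonneg)
  qed
  \<comment> \<open>The size is rounded up to an integer. \<open>p i\<close> is the density that
    results and \<open>q i\<close> its excess over \<open>P\<close>; rounding up ensures
    \<open>a i \<le> q i\<close>, so passing from \<open>a\<close> to \<open>q\<close> loses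
    nothing.\<close>
  define \<kappa> where "\<kappa> i = nat \<lceil>(P + a i) * card (Y i)\<rceil>" for i
  define p where "p i = real (\<kappa> i) / card (Y i)" for i
  define q where "q i = p i - P" for i
  have \<kappa>1: "\<kappa> i \<le> card (nb i x (Y i))" if "i < r" "x \<in> X" for i x
    using deg[OF that] unfolding \<kappa>_def by (simp add: ceiling_le_iff nat_le_iff)
  have \<kappa>2: "\<kappa> i \<le> card (Y i)" if "i < r" for i
    using \<kappa>1[OF that x0] card_mono[OF fin(3)[OF that] nb_subset] by (meson le_trans)
  have \<kappa>3: "(P + a i) * card (Y i) \<le> \<kappa> i" for i
    unfolding \<kappa>_def by linarith
  have \<kappa>0: "0 < \<kappa> i" if "i < r" for i
  proof -
    have "0 < (P + a i) * card (Y i)" using par apos[OF that] cardY[OF that] by simp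
    then show ?thesis using \<kappa>3[of i] by linarith
  qed
  have p1: "p i \<le> 1" if "i < r" for i
    using \<kappa>2[OF that] cardY[OF that] by (simp add: p_def)
  have qa: "a i \<le> q i" if "i < r" for i
  proof -
    have "P + a i \<le> p i" unfolding p_def using \<kappa>3[of i] cardY[OF that] by (simp add: pos_le_divide_eq)
    then show ?thesis by (simp add: q_def)
  qed
  have q0: "0 < q i" "q i \<le> 1" if "i < r" for i
    using qa[OF that] apos[OF that] p1[OF that] par by (auto simp: q_def)
  have lnq: "ln (a i) \<le> ln (q i)" "ln (a i) \<le> 0" if "i < r" for i
    using qa[OF that] apos[OF that] q0[OF that] by auto
  have p\<kappa>: "p i * card (Y i) = \<kappa> i" if "i < r" for i using cardY[OF that] by (simp add: p_def)
  have ln\<kappa>: "ln P + ln (card (Y i)) \<le> ln (\<kappa> i)" if "i < r" for i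
  proof -
    have "ln (P * card (Y i)) \<le> ln (\<kappa> i)"
      using \<kappa>3[of i] apos[OF that] par cardY[OF that] \<kappa>0[OF that]
      by (intro ln_mono) (auto simp: algebra_simps intro: order_trans[rotated])
    then show ?thesis using par cardY[OF that] by (simp add: ln_mult)
  qed
  show ?case
  proof (cases "\<exists>j<r. n j = 0")
    \<comment> \<open>Colour \<open>j\<close> needs no further vertices, so \<open>Y j\<close>
      itself is the desired set; \<open>ln (a j) \<le> 0\<close> makes it large enough.\<close>
    case True
    then obtain j where j: "j < r" "n j = 0" by blast
    have "0 \<le> - D * ln (a j)" using lnq(2)[OF j(1)] par by (simp add: mult_nonneg_nonpos)
    then have "M \<le> ln (card (Y j))" using bigY[OF j(1)] j by simp
    moreover have "clique_free j (Y j) (b j)"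
      using free[OF j(1)] j by (auto intro: clique_free_subset)
    ultimately show ?thesis using j fin(4)[OF j(1)] by blast
  next
    case False
    then have npos: "0 < n i" if "i < r" for i using that by auto
    \<comment> \<open>With this unit a loss of one \<alpha> multiplies the excess \<open>q i\<close>
      by \<open>1 - 1 / t\<close>, and a gain of \<open>z ^ d - 2\<close> units multiplies it by
      \<open>1 + (z ^ d - 2) / t\<close>.\<close>
    have \<alpha>: "0 < q i / t" if "i < r" for i using q0[OF that] par by simp
    obtain x l z X' Y' where x: "x \<in> X" and l: "l < r" and z: "1 \<le> z" and X': "X' \<subseteq> X"
      and cardX': "exp (- (C * z)) * card X \<le> card X'"
      and Y': "\<And>i. i < r \<Longrightarrow> Y' i \<subseteq> nb i x (Y i)" "\<And>i. i < r \<Longrightarrow> card (Y' i) = \<kappa> i"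
      and low: "\<And>i y. i < r \<Longrightarrow> y \<in> X' \<Longrightarrow> (p i - q i / t) * \<kappa> i \<le> card (nb i y (Y' i))"
      and high: "\<And>y. y \<in> X' \<Longrightarrow> (p l + (z ^ d - 2) * (q l / t)) * \<kappa> l \<le> card (nb l y (Y' l))"
      by (rule key_lemma[where X = X and Y = Y and \<kappa> = \<kappa> and \<alpha> = "\<lambda>i. q i / t" and p = p,
            OF fin(1,2) d m fin(3) \<kappa>1 \<kappa>0 \<alpha> p\<kappa>, folded C_def]) (assumption | rule that)+
    have "0 < exp (- (C * z)) * card X" using cardX by simp
    then have X'pos: "0 < card X'" using cardX' by linarith
    then have X'ne: "X' \<noteq> {}" by auto
    have finX': "finite X'" using X' fin finite_subset by blast
    have finY': "finite (Y' i)" "Y' i \<noteq> {}" if "i < r" for i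
      using Y'[OF that] \<kappa>0[OF that] by (auto intro: card_ge_0_finite)
    have Y'Y: "Y' i \<subseteq> Y i" if "i < r" for i using Y'(1)[OF that] nb_subset by blast
    have lnX': "ln (card X) - C * z \<le> ln (card X')"
    proof -
      have "ln (exp (- (C * z)) * card X) \<le> ln (card X')"
        using cardX' cardX by (intro ln_mono) auto
      then show ?thesis using cardX by (simp add: ln_mult)
    qed
    show ?thesis
    \<comment> \<open>For small \<open>z\<close> few vertices of \<open>X\<close> are lost and
      \<open>x\<close> is spent on a colour step; for large \<open>z\<close> the density gain pays
      for the loss.\<close>
    proof (cases "z \<le> z\<^sub>0")
      case True
      have Cz: "C * z \<le> C * z\<^sub>0" using True A0 by (intro mult_left_mono) auto
      have sumn: "1 \<le> (\<Sum>i<r. real (n i))"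
      proof -
        have "real (n 0) \<le> (\<Sum>i<r. real (n i))" using r_pos by (intro member_le_sum) auto
        then show ?thesis using npos[OF r_pos] by linarith
      qed
      have "A * 1 \<le> A * (\<Sum>i<r. real (n i))" using sumn A0 by (intro mult_left_mono) auto
      moreover have "0 \<le> - B * (\<Sum>i<r. ln (a i))"
        using lnq(2) par by (intro mult_nonpos_nonpos sum_nonpos) auto
      ultimately have "A \<le> ln (card X)" using bigX by simp
      then have "ln (2 * real r) \<le> ln (card X')"
        using lnX' Cz A par by (smt (verit) divide_nonneg_nonneg)
      then have "2 * real r \<le> card X'" using r_pos X'pos by simp
      then have two: "2 \<le> card X'" using r_pos by linarith
      \<comment> \<open>The factor 2 covers \<open>x\<close> itself, which may belong to
        \<open>X'\<close> but to none of its neighbourhoods.\<close>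
      have "\<exists>j<r. card X' \<le> 2 * r * card (nb j x X')"
      proof (rule ccontr)
        assume "\<not> ?thesis"
        then have "2 * r * card (nb j x X') < card X'" if "j < r" for j using that by (auto simp: not_le)
        then have "(\<Sum>j<r. 2 * r * card (nb j x X')) < (\<Sum>j<r. card X')"
          using r_pos by (intro sum_strict_mono) auto
        then have "2 * card (X' - {x}) < card X'"
          using r_pos by (simp add: sum_distrib_left[symmetric] sum_card_nb[OF finX'])
        then show False using two finX' by (simp add: card_Diff_singleton_if split: if_splits)
      qed
      then obtain j where j: "j < r" "card X' \<le> 2 * r * card (nb j x X')" by blast
      define X'' where "X'' = nb j x X'"
      have X'': "X'' \<subseteq> X'" "finite X''" unfolding X''_def using nb_subset finite_nb finX' by auto
      have X''pos: "0 < card X''" using j two unfolding X''_def by (intro gr0I) auto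
      have lnX'': "ln (card X) - C * z\<^sub>0 - ln (2 * real r) \<le> ln (card X'')"
      proof -
        have "real (card X') \<le> 2 * real r * card X''"
          using j(2) unfolding X''_def by (metis of_nat_le_iff of_nat_mult of_nat_numeral)
        then have "ln (card X') \<le> ln (2 * real r * card X'')"
          using X'pos by (intro ln_mono) auto
        also have "\<dots> = ln (2 * real r) + ln (card X'')"
          using r_pos X''pos by (simp add: ln_mult)
        finally show ?thesis using lnX' Cz by linarith
      qed
      \<comment> \<open>Only colour \<open>j\<close> moves to its new set; the other sets
        \<open>Y' i\<close> are discarded. The vertex \<open>x\<close> extends every clique of
        colour \<open>j\<close> inside \<open>X'' \<union> Y' j\<close>, so \<open>n j\<close> drops
        by one.\<close>
      define a' where "a' = a(j := q j * (1 - 1 / t))"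
      define n' where "n' = n(j := n j - 1)"
      define Z where "Z = Y(j := Y' j)"
      have a'j: "0 < q j * (1 - 1 / t)" using q0[OF j(1)] t1 by simp
      have lna': "ln (a j) - 2 / t \<le> ln (q j * (1 - 1 / t))"
        using lnq(1)[OF j(1)] neg_ln_one_minus_inverse[OF par(2)] ln_mult_pos[OF q0(1)[OF j(1)] t1(1)]
        by linarith
      have sn: "(\<Sum>i<r. real (n' i)) = (\<Sum>i<r. real (n i)) - 1"
        using sum_fun_upd[of "{..<r}" j "\<lambda>i v. real v" n "n j - 1"] j npos[OF j(1)]
        by (simp add: n'_def of_nat_diff)
      have sa: "(\<Sum>i<r. ln (a i)) - 2 / t \<le> (\<Sum>i<r. ln (a' i))"
        using sum_fun_upd[of "{..<r}" j "\<lambda>i v. ln v" a "q j * (1 - 1 / t)"] j lna'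
        by (simp add: a'_def)
      have "\<exists>k<r. \<exists>V\<subseteq>Z k. V \<noteq> {} \<and> clique_free k V (b k) \<and> M \<le> ln (card V)"
      proof (rule less.hyps)
        have "(\<Sum>i<r. n' i) < (\<Sum>i<r. n i)"
          using sum_fun_upd[of "{..<r}" j "\<lambda>i v. v" n "n j - 1"] j npos[OF j(1)]
          by (simp add: n'_def)
        moreover have "(\<Sum>i<r. card (Z i)) \<le> (\<Sum>i<r. card (Y i))"
          unfolding Z_def using Y'(2) \<kappa>2 j by (intro sum_mono) auto
        ultimately show "(\<Sum>i<r. n' i) + (\<Sum>i<r. card (Z i)) < (\<Sum>i<r. n i) + (\<Sum>i<r. card (Y i))"
          by linarith
      next
        fix i y assume i: "i < r" and y: "y \<in> X''"
        show "(P + a' i) * card (Z i) \<le> card (nb i y (Z i))"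
        proof (cases "i = j")
          case True
          have "P + q j * (1 - 1 / t) = p j - q j / t" by (simp add: q_def algebra_simps diff_divide_distrib)
          then show ?thesis
            using True low[OF j(1), of y] y X''(1) Y'(2)[OF j(1)] by (auto simp: a'_def Z_def)
        next
          case False
          then show ?thesis using deg[OF i, of y] y X''(1) X' by (auto simp: a'_def Z_def)
        qed
      next
        fix i assume i: "i < r"
        show "\<delta> \<le> a' i * (1 - 1 / t) ^ n' i"
        proof (cases "i = j")
          case True
          have "\<delta> \<le> a j * (1 - 1 / t) ^ n j" using a[OF j(1)] .
          also have "\<dots> \<le> q j * (1 - 1 / t) ^ n j"
            using qa[OF j(1)] t1 by (intro mult_right_mono) auto
          also have "\<dots> = q j * (1 - 1 / t) * (1 - 1 / t) ^ (n j - 1)"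
            using npos[OF j(1)] by (cases "n j") auto
          finally show ?thesis using True by (simp add: a'_def n'_def)
        qed (use a[OF i] in \<open>simp add: a'_def n'_def\<close>)
      next
        have "A * (\<Sum>i<r. real (n' i)) - B * (\<Sum>i<r. ln (a' i))
            \<le> A * ((\<Sum>i<r. real (n i)) - 1) - B * ((\<Sum>i<r. ln (a i)) - 2 / t)"
          using mult_left_mono[OF sa par(5)] by (simp add: sn)
        also have "\<dots> = A * (\<Sum>i<r. real (n i)) - B * (\<Sum>i<r. ln (a i)) - (A - 2 * B / t)"
          by (simp add: algebra_simps)
        also have "\<dots> \<le> ln (card X'')" using bigX lnX'' A by linarith
        finally show "A * (\<Sum>i<r. real (n' i)) - B * (\<Sum>i<r. ln (a' i)) \<le> ln (card X'')" .
      next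
        fix i assume i: "i < r"
        show "n' i * Q - D * ln (a' i) + M \<le> ln (card (Z i))"
        proof (cases "i = j")
          case True
          have "real (n j - 1) * Q - D * ln (q j * (1 - 1 / t)) + M
              \<le> (real (n j) - 1) * Q - D * (ln (a j) - 2 / t) + M"
            using mult_left_mono[OF lna' par(4)] npos[OF j(1)] by (simp add: of_nat_diff)
          also have "\<dots> = n j * Q - D * ln (a j) + M - (Q - 2 * D / t)"
            by (simp add: algebra_simps)
          also have "\<dots> \<le> ln (\<kappa> j)" using bigY[OF j(1)] ln\<kappa>[OF j(1)] Q by linarith
          finally show ?thesis using True Y'(2)[OF j(1)] by (simp add: n'_def a'_def Z_def)
        qed (use bigY[OF i] in \<open>simp add: n'_def a'_def Z_def\<close>)
      next
        fix i assume i: "i < r"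
        show "clique_free i (X'' \<union> Z i) (b i + n' i)"
        proof (cases "i = j")
          case True
          have "b j + n j = Suc (b j + (n j - 1))" using npos[OF j(1)] by simp
          then have "clique_free j (nb j x (X \<union> Y j)) (b j + (n j - 1))"
            using clique_free_nb[of j "X \<union> Y j"] free[OF j(1)] x by auto
          moreover have "X'' \<union> Z j \<subseteq> nb j x (X \<union> Y j)"
            using X' Y'(1)[OF j(1)] by (auto simp: X''_def Z_def nb_def)
          ultimately show ?thesis using True by (auto simp: n'_def intro: clique_free_subset)
        next
          case False
          have "X'' \<union> Z i \<subseteq> X \<union> Y i" using False X''(1) X' by (auto simp: Z_def)
          then show ?thesis using False free[OF i] by (auto simp: n'_def intro: clique_free_subset)
        qed
      qed (use X'' X''pos finY' fin j in \<open>auto simp: Z_def\<close>)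
      moreover have "Z k \<subseteq> Y k" for k using Y'Y[OF j(1)] by (simp add: Z_def)
      ultimately show ?thesis by (meson subset_trans)
    next
      case False
      then have zz: "z\<^sub>0 < z" by simp
      define \<nu> where "\<nu> = z ^ d - 2"
      have "z\<^sub>0 ^ d < z ^ d" using zz par d by (intro power_strict_mono) auto
      then have \<nu>: "0 < \<nu>" using par by (simp add: \<nu>_def)
      obtain y where y: "y \<in> X'" using X'ne by blast
      \<comment> \<open>No density exceeds 1. This caps \<open>\<nu>\<close> at
        \<open>t / \<delta>\<close>, as \<open>boostX\<close> demands, and also forces
        \<open>p l < 1\<close>, so that the boost strictly shrinks \<open>Y l\<close>.\<close>
      have "(p l + \<nu> * (q l / t)) * \<kappa> l \<le> 1 * \<kappa> l"
        using high[OF y] card_mono[OF finY'(1)[OF l] nb_subset[of l y]] Y'(2)[OF l]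
        by (simp add: \<nu>_def)
      then have le1: "p l + \<nu> * (q l / t) \<le> 1" using \<kappa>0[OF l] by simp
      have pl: "0 < p l" using \<kappa>0[OF l] cardY[OF l] by (simp add: p_def)
      have \<nu>q: "0 < \<nu> * (q l / t)" using \<nu> \<alpha>[OF l] by (rule mult_pos_pos)
      have "\<nu> * q l \<le> t" 
      proof -
        have "\<nu> * (q l / t) \<le> 1" using le1 pl by linarith
        then show ?thesis using par by (simp add: pos_divide_le_eq)
      qed
      moreover have "\<nu> * \<delta> \<le> \<nu> * q l" using \<nu> apos(1)[OF l] qa[OF l] by (intro mult_left_mono) auto
      ultimately have "\<nu> \<le> t / \<delta>" using par by (simp add: pos_le_divide_eq)
      then have bX: "C * z \<le> B * ln (1 + \<nu> / t)" using boostX[OF zz] by (simp add: \<nu>_def)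
      have bY: "- ln P \<le> D * ln (1 + \<nu> / t)" using boostY[OF zz] by (simp add: \<nu>_def)
      have f1: "1 < 1 + \<nu> / t" using \<nu> par by simp
      define v where "v = q l * (1 + \<nu> / t)"
      define a' where "a' = a(l := v)"
      define Z where "Z = Y(l := Y' l)"
      have vq: "q l \<le> v" using q0[OF l] f1 by (simp add: v_def)
      have lnv: "ln (a l) + ln (1 + \<nu> / t) \<le> ln v"
        using lnq(1)[OF l] q0[OF l] f1 by (simp add: v_def ln_mult)
      have sa: "(\<Sum>i<r. ln (a i)) + ln (1 + \<nu> / t) \<le> (\<Sum>i<r. ln (a' i))"
        using sum_fun_upd[of "{..<r}" l "\<lambda>i v. ln v" a v] l lnv by (simp add: a'_def)
      have "\<kappa> l < card (Y l)" 
      proof -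
        have "p l < 1" using le1 \<nu>q by linarith
        then show ?thesis using cardY[OF l] by (simp add: p_def)
      qed
      have "\<exists>k<r. \<exists>V\<subseteq>Z k. V \<noteq> {} \<and> clique_free k V (b k) \<and> M \<le> ln (card V)"
      proof (rule less.hyps)
        have "(\<Sum>i<r. card (Z i)) < (\<Sum>i<r. card (Y i))"
          using sum_fun_upd[of "{..<r}" l "\<lambda>i. card" Y "Y' l"] l \<open>\<kappa> l < card (Y l)\<close> Y'(2)[OF l]
          by (simp add: Z_def)
        then show "(\<Sum>i<r. n i) + (\<Sum>i<r. card (Z i)) < (\<Sum>i<r. n i) + (\<Sum>i<r. card (Y i))"
          by simp
      next
        fix i y assume i: "i < r" and y: "y \<in> X'"
        show "(P + a' i) * card (Z i) \<le> card (nb i y (Z i))"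
        proof (cases "i = l")
          case True
          have "P + v = p l + (z ^ d - 2) * (q l / t)"
            by (simp add: v_def q_def \<nu>_def algebra_simps diff_divide_distrib)
          then show ?thesis using True high[OF y] Y'(2)[OF l] by (simp add: a'_def Z_def)
        next
          case False
          then show ?thesis using deg[OF i, of y] y X' by (auto simp: a'_def Z_def)
        qed
      next
        fix i assume i: "i < r"
        show "\<delta> \<le> a' i * (1 - 1 / t) ^ n i"
        proof (cases "i = l")
          case True
          have "\<delta> \<le> a l * (1 - 1 / t) ^ n l" using a[OF l] .
          also have "\<dots> \<le> v * (1 - 1 / t) ^ n l"
            using qa[OF l] vq t1 by (intro mult_right_mono) auto
          finally show ?thesis using True by (simp add: a'_def)
        qed (use a[OF i] in \<open>simp add: a'_def\<close>)
      next
        show "A * (\<Sum>i<r. real (n i)) - B * (\<Sum>i<r. ln (a' i)) \<le> ln (card X')"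
          using mult_left_mono[OF sa par(5)] bigX lnX' bX by (simp add: algebra_simps)
      next
        fix i assume i: "i < r"
        show "n i * Q - D * ln (a' i) + M \<le> ln (card (Z i))"
        proof (cases "i = l")
          case True
          show ?thesis
            using True mult_left_mono[OF lnv par(4)] bigY[OF l] ln\<kappa>[OF l] bY Y'(2)[OF l]
            by (simp add: a'_def Z_def algebra_simps)
        qed (use bigY[OF i] in \<open>simp add: a'_def Z_def\<close>)
      next
        fix i assume i: "i < r"
        have "X' \<union> Z i \<subseteq> X \<union> Y i" using X' Y'Y[OF l] by (auto simp: Z_def)
        then show "clique_free i (X' \<union> Z i) (b i + n i)"
          using free[OF i] by (rule clique_free_subset[rotated])
      qed (use finX' X'ne finY' fin l in \<open>auto simp: Z_def\<close>)
      moreover have "Z k \<subseteq> Y k" for k using Y'Y[OF l] by (simp add: Z_def)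
      ultimately show ?thesis by (meson subset_trans)
    qed
  qed
qed

end

section \<open>Erdos--Szekeres bounds\<close>

text \<open>With u = v * v the bound \<open>ln v \<ge> 1 - 1 / v\<close> leaves the surplus
  \<open>(v - 1)\<^sup>2\<close>. Multiplied by \<open>(v + 1)\<^sup>2\<close> it becomes
  \<open>(u - 1)\<^sup>2\<close>, and for \<open>u \<le> 3\<close> that factor is at most 8, because
  9/5 exceeds the root of 3.\<close>

lemma entropy_deviation:
  fixes u :: real
  assumes "0 < u"
  shows "u - 1 \<le> u * ln u" and "u \<le> 3 \<Longrightarrow> u - 1 + (u - 1)\<^sup>2 / 8 \<le> u * ln u"
proof -
  define v where "v = sqrt u"
  have v: "0 < v" "u = v\<^sup>2" using assms by (auto simp: v_def)
  have "ln (1 / v) \<le> 1 / v - 1" using v by (intro ln_le_minus_one) auto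
  then have "1 - 1 / v \<le> ln v" using v by (simp add: ln_div)
  moreover have "ln u = 2 * ln v" using v by (simp add: ln_realpow)
  ultimately have "2 - 2 / v \<le> ln u" by simp
  then have "u * (2 - 2 / v) \<le> u * ln u" using assms by (intro mult_left_mono) auto
  moreover have "u * (2 - 2 / v) = u - 1 + (v - 1)\<^sup>2"
    using v by (simp add: power2_eq_square field_simps)
  ultimately have main: "u - 1 + (v - 1)\<^sup>2 \<le> u * ln u" by simp
  show "u - 1 \<le> u * ln u" using main zero_le_power2[of "v - 1"] by linarith
  assume "u \<le> 3"
  then have "v\<^sup>2 \<le> (9/5)\<^sup>2" using v by (simp add: power2_eq_square)
  then have "v \<le> 9/5" by (rule power2_le_imp_le) simp
  then have "(v + 1)\<^sup>2 \<le> (14/5)\<^sup>2" using v by (intro power_mono) auto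
  then have "(v + 1)\<^sup>2 \<le> 8" by (simp add: power2_eq_square)
  then have "(v - 1)\<^sup>2 * (v + 1)\<^sup>2 \<le> (v - 1)\<^sup>2 * 8" by (intro mult_left_mono) auto
  moreover have "(v - 1)\<^sup>2 * (v + 1)\<^sup>2 = (u - 1)\<^sup>2"
    using v by (simp add: power2_eq_square algebra_simps)
  ultimately show "u - 1 + (u - 1)\<^sup>2 / 8 \<le> u * ln u" using main by simp
qed

context edge_coloring
begin

text \<open>The extra \<open>+ 1\<close> absorbs the vertex that is removed in each step.\<close>

lemma erdos_szekeres:
  fixes x :: "nat \<Rightarrow> real"
  assumes "2 \<le> r" "finite W" "\<And>i. i < r \<Longrightarrow> clique_free i W (k i)"
    and x: "\<And>i. i < r \<Longrightarrow> 0 < x i" "(\<Sum>i<r. x i) \<le> 1"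
  shows "real (card W) + 1 \<le> (\<Prod>i<r. (1 / x i) ^ k i)"
  using assms(2,3)
proof (induction "\<Sum>i<r. k i" arbitrary: W k rule: less_induct)
  case less
  have x1: "x i \<le> 1" if "i < r" for i
  proof -
    have "x i \<le> (\<Sum>i<r. x i)" using that x(1) by (intro member_le_sum) (auto simp: less_imp_le)
    then show ?thesis using x(2) by linarith
  qed
  let ?F = "\<Prod>i<r. (1 / x i) ^ k i"
  show ?case
  proof (cases "W = {}")
    case True
    have "1 \<le> ?F" using x(1) x1 by (intro prod_ge_1) (auto intro!: one_le_power)
    then show ?thesis using True by simp
  next
    case False
    then obtain v where v: "v \<in> W" by blast
    have kpos: "0 < k i" if "i < r" for i
      using less.prems(2)[OF that] not_clique_free_0 by (metis gr0I)
    have step: "real (card (nb i v W)) + 1 \<le> x i * ?F" if i: "i < r" for i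
    proof -
      let ?k = "k(i := k i - 1)"
      have "real (card (nb i v W)) + 1 \<le> (\<Prod>l<r. (1 / x l) ^ ?k l)"
      proof (rule less.hyps)
        show "(\<Sum>l<r. ?k l) < (\<Sum>l<r. k l)"
          using sum_fun_upd[of "{..<r}" i "\<lambda>i v. v" k "k i - 1"] i kpos[OF i] by simp
        show "clique_free l (nb i v W) (?k l)" if "l < r" for l
        proof (cases "l = i")
          case True
          then show ?thesis
            using less.prems(2)[OF i] v kpos[OF i] by (auto intro!: clique_free_nb)
        next
          case False
          then show ?thesis
            using less.prems(2)[OF that] by (auto intro: clique_free_subset[OF _ nb_subset])
        qed
      qed (use less.prems finite_nb in auto)
      also have "\<dots> = x i * ?F"
      proof -
        let ?R = "\<Prod>l\<in>{..<r}-{i}. (1 / x l) ^ k l"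
        have "(\<Prod>l<r. (1 / x l) ^ ?k l) = (1 / x i) ^ (k i - 1) * (\<Prod>l\<in>{..<r}-{i}. (1 / x l) ^ ?k l)"
          using i by (subst prod.remove[of _ i]) auto
        also have "(\<Prod>l\<in>{..<r}-{i}. (1 / x l) ^ ?k l) = ?R" by (intro prod.cong) auto
        also have "(1 / x i) ^ (k i - 1) = x i * (1 / x i) ^ k i"
          using kpos[OF i] x(1)[OF i] by (cases "k i") auto
        also have "x i * (1 / x i) ^ k i * ?R = x i * ?F"
          using i by (subst prod.remove[of "{..<r}" i]) auto
        finally show ?thesis .
      qed
      finally show ?thesis .
    qed
    have F0: "0 \<le> ?F" using x(1) by (intro prod_nonneg) (auto simp: less_imp_le)
    have "(\<Sum>i<r. real (card (nb i v W)) + 1) \<le> (\<Sum>i<r. x i * ?F)"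
      using step by (intro sum_mono) auto
    also have "\<dots> = (\<Sum>i<r. x i) * ?F" by (simp add: sum_distrib_right)
    also have "\<dots> \<le> 1 * ?F" using x(2) F0 by (intro mult_right_mono)
    \<comment> \<open>Of the \<open>r\<close> ones collected here, one accounts for \<open>v\<close>
      and one for the \<open>+ 1\<close> of the claim, which is why two colours are
      required.\<close>
    finally have "real (\<Sum>i<r. card (nb i v W)) + real r \<le> ?F" by (simp add: sum.distrib)
    moreover have "(\<Sum>i<r. card (nb i v W)) + 1 = card W"
      using sum_card_nb[OF less.prems(1)] less.prems(1) v by (metis Suc_eq_plus1 card_Suc_Diff1)
    ultimately show ?thesis using assms(1) by linarith
  qed
qed

lemma erdos_szekeres_diagonal:
  assumes "2 \<le> r" "finite W" "\<And>i. i < r \<Longrightarrow> clique_free i W (k i)" "W \<noteq> {}"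
  shows "ln (card W) \<le> (\<Sum>i<r. k i) * ln r"
proof -
  have "real (card W) + 1 \<le> (\<Prod>i<r. (1 / (1 / real r)) ^ k i)"
    by (rule erdos_szekeres[OF assms(1-3)]) (use r_pos in auto)
  also have "\<dots> = real r ^ (\<Sum>i<r. k i)" by (simp add: power_sum)
  finally have "real (card W) \<le> real r ^ (\<Sum>i<r. k i)" by linarith
  moreover have "0 < real (card W)" using assms(2,4) by (simp add: card_gt_0_iff)
  ultimately have "ln (card W) \<le> ln (real r ^ (\<Sum>i<r. k i))" by (intro ln_mono)
  then show ?thesis using r_pos by (simp add: ln_realpow)
qed

text \<open>Weights proportional to the clique sizes turn the bound into an entropy. Relative to the
  average, the terms \<open>u i * ln (u i)\<close> dominate \<open>u i - 1\<close>, whose sum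
  vanishes, and colour \<open>j\<close> adds the quadratic surplus of
  \<open>entropy_deviation\<close>.\<close>

lemma erdos_szekeres_deviation:
  fixes k :: "nat \<Rightarrow> nat" and avg :: real
  defines "avg \<equiv> (\<Sum>i<r. real (k i)) / r"
  assumes "2 \<le> r" "finite W" "\<And>i. i < r \<Longrightarrow> clique_free i W (k i)" "W \<noteq> {}"
    and k: "\<And>i. i < r \<Longrightarrow> k i \<le> 3 * avg" and j: "j < r"
  shows "ln (card W) \<le> (\<Sum>i<r. k i) * ln r - (k j - avg)\<^sup>2 / (8 * avg)"
proof -
  let ?N = "\<Sum>i<r. real (k i)"
  have kpos: "0 < k i" if "i < r" for i
    using assms(4)[OF that] not_clique_free_0 by (metis gr0I)
  have N: "0 < ?N" using kpos r_pos by (intro sum_pos) (auto simp: lessThan_empty_iff)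
  have avg: "0 < avg" using N r_pos by (simp add: avg_def)
  define u where "u i = k i / avg" for i
  have u: "0 < u i" "u i \<le> 3" if "i < r" for i
    using kpos[OF that] k[OF that] avg by (auto simp: u_def field_simps)
  have su: "(\<Sum>i<r. u i) = r"
    using N r_pos by (simp add: u_def sum_divide_distrib[symmetric]) (simp add: avg_def)
  have xs: "(\<Sum>i<r. k i / ?N) \<le> 1" using N by (simp add: sum_divide_distrib[symmetric])
  have "real (card W) + 1 \<le> (\<Prod>i<r. (1 / (k i / ?N)) ^ k i)"
    by (rule erdos_szekeres[OF assms(2-4) _ xs]) (use kpos N in auto)
  then have "real (card W) \<le> (\<Prod>i<r. (1 / (k i / ?N)) ^ k i)" by linarith
  moreover have "0 < real (card W)" using assms(3,5) by (simp add: card_gt_0_iff)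
  ultimately have "ln (card W) \<le> ln (\<Prod>i<r. (1 / (k i / ?N)) ^ k i)" by (intro ln_mono)
  also have "\<dots> = (\<Sum>i<r. k i * ln (1 / (k i / ?N)))"
    using kpos N by (subst ln_prod) (auto simp: ln_realpow)
  also have "\<dots> = (\<Sum>i<r. k i * ln r - avg * (u i * ln (u i)))"
  proof (rule sum.cong)
    fix i assume "i \<in> {..<r}"
    then have i: "0 < k i" using kpos by simp
    have "1 / (k i / ?N) = r / u i" using avg r_pos by (simp add: u_def avg_def)
    moreover have "0 < u i" using i avg by (simp add: u_def)
    ultimately have "ln (1 / (k i / ?N)) = ln r - ln (u i)" using r_pos by (simp add: ln_div)
    moreover have "avg * u i = k i" using avg by (simp add: u_def)
    ultimately show "k i * ln (1 / (k i / ?N)) = k i * ln r - avg * (u i * ln (u i))"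
      by (simp add: right_diff_distrib flip: mult.assoc)
  qed simp
  also have "\<dots> = (\<Sum>i<r. k i) * ln r - avg * (\<Sum>i<r. u i * ln (u i))"
    by (simp add: sum_subtractf sum_distrib_left sum_distrib_right)
  also have "\<dots> \<le> (\<Sum>i<r. k i) * ln r - avg * ((u j - 1)\<^sup>2 / 8)"
  proof -
    have "(\<Sum>i<r. u i * ln (u i)) = u j * ln (u j) + (\<Sum>i\<in>{..<r}-{j}. u i * ln (u i))"
      using j by (intro sum.remove) auto
    moreover have "(\<Sum>i<r. u i - 1) = (u j - 1) + (\<Sum>i\<in>{..<r}-{j}. u i - 1)"
      using j by (intro sum.remove) auto
    moreover have "(\<Sum>i\<in>{..<r}-{j}. u i - 1) \<le> (\<Sum>i\<in>{..<r}-{j}. u i * ln (u i))"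
      using entropy_deviation(1) u by (intro sum_mono) auto
    moreover have "u j - 1 + (u j - 1)\<^sup>2 / 8 \<le> u j * ln (u j)"
      using entropy_deviation(2) u[OF j] by auto
    moreover have "(\<Sum>i<r. u i - 1) = 0" using su by (simp add: sum_subtractf)
    ultimately have "(u j - 1)\<^sup>2 / 8 \<le> (\<Sum>i<r. u i * ln (u i))" by linarith
    then show ?thesis using avg by (intro diff_left_mono mult_left_mono) auto
  qed
  also have "avg * ((u j - 1)\<^sup>2 / 8) = (k j - avg)\<^sup>2 / (8 * avg)"
    using avg by (simp add: u_def power2_eq_square field_simps)
  finally show ?thesis .
qed

text \<open>Greedy descent: while some colour neighbourhood has at least the proportion
  \<open>g\<close>, pass to it and lower that clique size by one. The budget \<open>S\<close> makes
  this an induction; the run either exhausts it or ends with all colour degrees below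
  \<open>g\<close>.\<close>

lemma degree_reduction:
  fixes g :: real
  assumes V: "finite V" "\<And>i. i < r \<Longrightarrow> clique_free i V k" and g: "0 \<le> g"
  shows "\<exists>s \<kappa> W. s \<le> S \<and> W \<subseteq> V \<and> (\<forall>i<r. clique_free i W (\<kappa> i)) \<and> (\<Sum>i<r. \<kappa> i) + s = r * k
    \<and> (\<forall>i<r. \<kappa> i \<le> k) \<and> g ^ s * card V \<le> card W
    \<and> (s = S \<or> (\<forall>v\<in>W. \<forall>i<r. card (nb i v W) < g * card W))"
proof (induction S)
  case 0
  show ?case using V by (intro exI[of _ 0] exI[of _ "\<lambda>_. k"] exI[of _ V]) auto
next
  case (Suc S)
  then obtain s \<kappa> W where W: "s \<le> S" "W \<subseteq> V" "\<forall>i<r. clique_free i W (\<kappa> i)"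
    "(\<Sum>i<r. \<kappa> i) + s = r * k" "\<forall>i<r. \<kappa> i \<le> k" "g ^ s * card V \<le> card W"
    and alt: "s = S \<or> (\<forall>v\<in>W. \<forall>i<r. card (nb i v W) < g * card W)"
    by blast
  show ?case
  proof (cases "\<forall>v\<in>W. \<forall>i<r. card (nb i v W) < g * card W")
    case True
    then show ?thesis
      using W by (intro exI[of _ s] exI[of _ \<kappa>] exI[of _ W]) auto
  next
    case False
    then obtain v i where v: "v \<in> W" "i < r" "g * card W \<le> card (nb i v W)"
      by (auto simp: not_less)
    have s: "s = S" using alt False by blast
    have \<kappa>: "0 < \<kappa> i" using W(3) v(2) not_clique_free_0 by (metis gr0I)
    let ?\<kappa> = "\<kappa>(i := \<kappa> i - 1)"
    have "(\<Sum>l<r. ?\<kappa> l) + Suc S = r * k"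
      using sum_fun_upd[of "{..<r}" i "\<lambda>i v. v" \<kappa> "\<kappa> i - 1"] v(2) \<kappa> W(4) s by simp
    moreover have "g ^ Suc S * card V \<le> card (nb i v W)"
    proof -
      have "g * (g ^ S * card V) \<le> g * card W" using W(6) g s by (intro mult_left_mono) auto
      then show ?thesis using v(3) by (simp add: mult_ac)
    qed
    moreover have "\<forall>l<r. clique_free l (nb i v W) (?\<kappa> l)"
    proof (intro allI impI)
      fix l assume l: "l < r"
      show "clique_free l (nb i v W) (?\<kappa> l)"
      proof (cases "l = i")
        case True
        then show ?thesis using W(3) v \<kappa> by (auto intro!: clique_free_nb)
      next
        case False
        then show ?thesis using W(3) l by (auto intro: clique_free_subset[OF _ nb_subset])
      qed
    qed
    moreover have "nb i v W \<subseteq> V" using W(2) nb_subset by blast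
    moreover have "\<forall>l<r. ?\<kappa> l \<le> k" using W(5) by auto
    ultimately show ?thesis
      by (intro exI[of _ "Suc S"] exI[of _ ?\<kappa>] exI[of _ "nb i v W"]) auto
  qed
qed

end

section \<open>Choice of parameters\<close>

lemma half_le_ln_one_plus:
  fixes v :: real
  assumes "0 \<le> v" "v \<le> 1"
  shows "v / 2 \<le> ln (1 + v)"
proof -
  have "ln (1 / (1 + v)) \<le> 1 / (1 + v) - 1" using assms by (intro ln_le_minus_one) auto
  moreover have "ln (1 / (1 + v)) = - ln (1 + v)" using assms by (simp add: ln_div)
  moreover have "v / 2 \<le> v / (1 + v)" using assms by (intro divide_left_mono) auto
  moreover have "v / (1 + v) = 1 - 1 / (1 + v)" using assms by (simp add: field_simps)
  ultimately show ?thesis by linarith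
qed

lemma quarter_le_ln_boost:
  fixes z t :: real
  assumes "4 \<le> z ^ d" "z ^ d - 2 \<le> t" "0 < t"
  shows "z ^ d / (4 * t) \<le> ln (1 + (z ^ d - 2) / t)"
proof -
  have "z ^ d / (4 * t) = z ^ d / 2 / t / 2" by simp
  also have "\<dots> \<le> (z ^ d - 2) / t / 2" using assms by (intro divide_right_mono) auto
  also have "\<dots> \<le> ln (1 + (z ^ d - 2) / t)" using assms by (intro half_le_ln_one_plus) auto
  finally show ?thesis .
qed

text \<open>Provides \<open>boostX\<close> of \<open>book\<close>, with
  \<open>z = z\<^sub>0 * w\<close>. For \<open>z ^ d - 2 \<le> t\<close> the logarithm is still of
  order \<open>z ^ d / t\<close>, which outgrows the linear cost. Beyond that it is at least 1/2,
  and the cap on \<open>z ^ d\<close> keeps \<open>w\<close> small.\<close>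

lemma boost_cost:
  fixes C \<mu> L t z z\<^sub>0 \<rho> :: real
  assumes z0: "z\<^sub>0 ^ d = 2 ^ 18 * (\<mu> * L\<^sup>2)" "0 < z\<^sub>0" "z\<^sub>0 < z" and C: "0 \<le> C" "C * z\<^sub>0 \<le> \<mu> * L / 32"
    and L: "2 \<le> L" and \<mu>: "1 \<le> \<mu>" and d: "3 \<le> d" and t: "1 \<le> t" and \<rho>: "1 \<le> \<rho>"
    and up: "z ^ d - 2 \<le> 2 ^ 17 * \<rho> * \<mu> * t" and big: "2 ^ 15 * \<rho> * L \<le> t\<^sup>2"
  shows "C * z \<le> \<mu> * t / 512 * ln (1 + (z ^ d - 2) / t)"
proof -
  define w where "w = z / z\<^sub>0"
  have w: "1 \<le> w" "z = z\<^sub>0 * w" using z0 by (auto simp: w_def)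
  have zd: "z ^ d = 2 ^ 18 * (\<mu> * L\<^sup>2) * w ^ d" by (simp add: w(2) power_mult_distrib z0(1))
  have wd: "w \<le> w ^ d" "w ^ 3 \<le> w ^ d"
    using w d power_increasing[of 1 d w] power_increasing[of 3 d w] by auto
  have L2: "4 \<le> L\<^sup>2" using L power_mono[of 2 L 2] by simp
  have \<mu>L: "1 * 4 \<le> \<mu> * L\<^sup>2" using \<mu> L2 by (intro mult_mono) auto
  have zw: "2 ^ 18 * (\<mu> * L\<^sup>2) * w \<le> z ^ d"
    unfolding zd using wd \<mu> by (intro mult_left_mono) auto
  have "4 * 1 \<le> 2 ^ 18 * (\<mu> * L\<^sup>2) * w"
    using w \<mu>L by (intro mult_mono) auto
  then have z4: "4 \<le> z ^ d" using zw by linarith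
  have "C * z = C * z\<^sub>0 * w" by (simp add: w)
  also have "\<dots> \<le> \<mu> * L / 32 * w" using C w by (intro mult_right_mono) auto
  finally have Cz: "C * z \<le> \<mu> * L * w / 32" by simp
  show ?thesis
  proof (cases "z ^ d - 2 \<le> t")
    case True
    have "\<mu> * L * w * 1 \<le> \<mu> * L * w * (2 ^ 12 * \<mu> * L)"
    proof (rule mult_left_mono)
      have "1 * 1 \<le> \<mu> * L" using \<mu> L by (intro mult_mono) auto
      then show "1 \<le> 2 ^ 12 * \<mu> * L" by simp
    qed (use \<mu> L w in auto)
    also have "\<dots> = 2 ^ 12 * \<mu>\<^sup>2 * L\<^sup>2 * w" by (simp add: power2_eq_square)
    finally have "\<mu> * L * w / 32 \<le> \<mu> * (2 ^ 18 * (\<mu> * L\<^sup>2) * w) / 2048"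
      by (simp add: power2_eq_square mult_ac)
    also have "\<dots> \<le> \<mu> * z ^ d / 2048" using zw \<mu> by (intro divide_right_mono mult_left_mono) auto
    also have "\<dots> = \<mu> * t / 512 * (z ^ d / (4 * t))" using t by simp
    also have "\<dots> \<le> \<mu> * t / 512 * ln (1 + (z ^ d - 2) / t)"
      using quarter_le_ln_boost[OF z4 True] t \<mu> by (intro mult_left_mono) auto
    finally show ?thesis using Cz by linarith
  next
    case False
    have "1 / 2 \<le> ln (1 + 1 :: real)" using half_le_ln_one_plus[of 1] by simp
    also have "\<dots> \<le> ln (1 + (z ^ d - 2) / t)" using False t by (intro ln_mono) (auto simp: field_simps)
    finally have ln: "1 / 2 \<le> ln (1 + (z ^ d - 2) / t)" .
    have "2 ^ 18 * (\<mu> * L\<^sup>2) * w ^ 3 \<le> z ^ d" unfolding zd using wd \<mu> by (intro mult_left_mono) auto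
    also have "\<dots> \<le> 2 ^ 17 * \<rho> * \<mu> * t + 2" using up by simp
    also have "\<dots> \<le> 2 ^ 18 * \<rho> * \<mu> * t"
    proof -
      have "1 * (1 * 1) \<le> \<mu> * (\<rho> * t)" using \<rho> \<mu> t by (intro mult_mono) auto
      then show ?thesis by simp
    qed
    finally have "\<mu> * (L\<^sup>2 * w ^ 3) \<le> \<mu> * (\<rho> * t)" by (simp add: mult_ac)
    then have a: "L\<^sup>2 * w ^ 3 \<le> \<rho> * t" using \<mu> by simp
    \<comment> \<open>This is where \<open>d \<ge> 3\<close> enters: the cap controls
      \<open>w ^ 3\<close>, and \<open>big\<close> supplies the missing factor for a comparison of
      cubes.\<close>
    have "(32 * L * w) ^ 3 = 2 ^ 15 * L * (L\<^sup>2 * w ^ 3)" by (simp add: power_mult_distrib power2_eq_square power3_eq_cube)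
    also have "\<dots> \<le> 2 ^ 15 * L * (\<rho> * t)" using a L by (intro mult_left_mono) auto
    also have "\<dots> = (2 ^ 15 * \<rho> * L) * t" by simp
    also have "\<dots> \<le> t\<^sup>2 * t" using big t by (intro mult_right_mono) auto
    also have "\<dots> = t ^ 3" by (simp add: power2_eq_square power3_eq_cube)
    finally have "32 * L * w \<le> t" using L w t by (subst (asm) power_mono_iff) auto
    then have "\<mu> * (32 * L * w) \<le> \<mu> * t" using \<mu> by (intro mult_left_mono) auto
    then have "\<mu> * L * w / 32 \<le> \<mu> * t / 512 * (1 / 2)" by (simp add: mult_ac)
    also have "\<dots> \<le> \<mu> * t / 512 * ln (1 + (z ^ d - 2) / t)"
      using ln \<mu> t by (intro mult_left_mono) auto
    finally show ?thesis using Cz by linarith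
  qed
qed

text \<open>Provides \<open>boostY\<close> of \<open>book\<close>. The logarithm increases with
  \<open>z\<close>, so the threshold \<open>z\<^sub>0\<close> is the worst case.\<close>

lemma boost_density:
  fixes L t z z\<^sub>0 :: real
  assumes "4 \<le> z\<^sub>0 ^ d" "z\<^sub>0 ^ d \<le> t" "0 \<le> z\<^sub>0" "z\<^sub>0 < z" "0 \<le> L"
  shows "L \<le> 4 * t * L / z\<^sub>0 ^ d * ln (1 + (z ^ d - 2) / t)"
proof -
  have t: "0 < t" using assms by linarith
  have "z\<^sub>0 ^ d / (4 * t) \<le> ln (1 + (z\<^sub>0 ^ d - 2) / t)"
    using assms t by (intro quarter_le_ln_boost) auto
  also have "\<dots> \<le> ln (1 + (z ^ d - 2) / t)"
  proof (rule ln_mono)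
    show "0 < 1 + (z\<^sub>0 ^ d - 2) / t" using assms t by (intro add_pos_nonneg) auto
    have "z\<^sub>0 ^ d \<le> z ^ d" using assms by (intro power_mono) auto
    then show "1 + (z\<^sub>0 ^ d - 2) / t \<le> 1 + (z ^ d - 2) / t" using t by (simp add: divide_right_mono)
  qed
  finally have "4 * t * L / z\<^sub>0 ^ d * (z\<^sub>0 ^ d / (4 * t)) \<le> 4 * t * L / z\<^sub>0 ^ d * ln (1 + (z ^ d - 2) / t)"
    using assms t by (intro mult_left_mono) auto
  moreover have "4 * t * L / z\<^sub>0 ^ d * (z\<^sub>0 ^ d / (4 * t)) = L"
  proof -
    have "z\<^sub>0 ^ d \<noteq> 0" using assms by linarith
    then show ?thesis using t by simp
  qed
  ultimately show ?thesis by linarith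
qed

lemma one_minus_inverse_power:
  assumes "2 \<le> (t::nat)"
  shows "exp (- 2) \<le> (1 - 1 / real t) ^ t"
proof -
  have "- 2 / t \<le> ln (1 - 1 / t)" using neg_ln_one_minus_inverse[of t] assms by simp
  then have "t * (- 2 / t) \<le> t * ln (1 - 1 / t)" by (intro mult_left_mono) auto
  then have "- 2 \<le> ln ((1 - 1 / t) ^ t)" using assms by (simp add: ln_realpow)
  then show ?thesis using assms by (subst (asm) ln_ge_iff) auto
qed

text \<open>Applied to the imbalance of colour \<open>j\<close> before and after its clique size is
  lowered by \<open>t\<close>.\<close>

lemma square_large_of_far_apart:
  fixes x y t :: real
  assumes "t / 2 \<le> \<bar>x - y\<bar>" "0 \<le> t"
  shows "t\<^sup>2 / 16 \<le> x\<^sup>2 \<or> t\<^sup>2 / 16 \<le> y\<^sup>2"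
proof -
  have "t / 4 \<le> \<bar>x\<bar> \<or> t / 4 \<le> \<bar>y\<bar>" using assms by linarith
  then have "(t / 4)\<^sup>2 \<le> \<bar>x\<bar>\<^sup>2 \<or> (t / 4)\<^sup>2 \<le> \<bar>y\<bar>\<^sup>2" using assms by (metis power_mono divide_nonneg_nonneg zero_le_numeral)
  then show ?thesis by (simp add: power_divide)
qed

context edge_coloring
begin

text \<open>
  The threshold \<open>z\<^sub>0\<close> between colour steps and boosts balances both costs: the colour steps lose
  \<open>r t C z\<^sub>0\<close> in \<open>ln (card X)\<close>, the boosts lose about \<open>t L\<^sup>2 / z\<^sub>0 ^ d\<close> in \<open>ln (card Y)\<close>, which
  must stay below \<open>t / \<mu>\<close>.
\<close>

lemma book_application:
  fixes \<mu> L :: real and t d m :: nat and \<kappa> :: "nat \<Rightarrow> nat"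
  assumes r2: "2 \<le> r" and d: "3 \<le> d" and m: "4 * real r + 2 \<le> 4 ^ m" "m \<le> 2 * L"
    and L: "2 \<le> L" "ln (2 * real r) \<le> L"
    and \<mu>1: "2 ^ 28 * real r \<le> \<mu>"
    and \<mu>2: "2 ^ 18 * (\<mu> * L\<^sup>2) * (768 * real r * (real d)\<^sup>2) ^ d \<le> \<mu> ^ d"
    and \<mu>3: "ln (8192 * real r * \<mu>) \<le> 24 * L"
    and t: "2 ^ 18 * (\<mu> * L\<^sup>2) \<le> t" "2 ^ 15 * real r * L \<le> (real t)\<^sup>2"
    and W: "finite W" "W \<noteq> {}" "r * \<mu> * t * L / 8 \<le> ln (card W)"
    and deg: "\<And>i v. i < r \<Longrightarrow> v \<in> W \<Longrightarrow> (1 - 1 / (8192 * \<mu>)) / r * card W \<le> card (nb i v W)"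
    and free: "\<And>i. i < r \<Longrightarrow> clique_free i W (\<kappa> i)" "\<And>i. i < r \<Longrightarrow> t \<le> \<kappa> i"
  shows "\<exists>j<r. \<exists>Y\<subseteq>W. Y \<noteq> {} \<and> clique_free j Y (\<kappa> j - t)
    \<and> ln (card W) - t * ln r - t / (1024 * \<mu>) \<le> ln (card Y)"
proof -
  have "2 \<le> real r" using r2 by simp
  then have \<mu>: "2 ^ 29 \<le> \<mu>" "0 < \<mu>" using \<mu>1 by simp_all
  have L2: "4 \<le> L\<^sup>2" using L power_mono[of 2 L 2] by simp
  have \<mu>L: "4 \<le> \<mu> * L\<^sup>2" using mult_mono[of 1 \<mu> 4 "L\<^sup>2"] \<mu> L2 by simp
  have t2: "2 \<le> real t" using t(1) \<mu>L by simp
  define \<theta> where "\<theta> = 1 / (8192 * \<mu>)"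
  have \<theta>: "0 < \<theta>" "\<theta> \<le> 1 / 4" using \<mu> by (auto simp: \<theta>_def field_simps)
  \<comment> \<open>The given minimum density (1 - \<theta>) / r is split into the base value
    \<open>P\<close> and the initial excess \<open>\<delta>\<close>.\<close>
  define \<delta> where "\<delta> = \<theta> / r"
  define P where "P = (1 - 2 * \<theta>) / r"
  have r0: "0 < real r" using r_pos by simp
  have \<delta>: "0 < \<delta>" using \<theta> r0 by (simp add: \<delta>_def)
  have P: "0 < P" using \<theta> r0 by (simp add: P_def)
  have P\<delta>: "P + \<delta> = (1 - 1 / (8192 * \<mu>)) / r"
    by (simp add: P_def \<delta>_def \<theta>_def[symmetric] add_divide_distrib[symmetric])
  have ln\<delta>: "- ln \<delta> \<le> 24 * L"
  proof -
    have "\<delta> = 1 / (8192 * real r * \<mu>)" by (simp add: \<delta>_def \<theta>_def mult_ac)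
    then have "- ln \<delta> = ln (8192 * real r * \<mu>)" using r0 \<mu> by (simp add: ln_div)
    then show ?thesis using \<mu>3 by simp
  qed
  have lnP: "- ln P \<le> ln r + 4 * \<theta>"
  proof -
    have "ln (1 / (1 - 2 * \<theta>)) \<le> 1 / (1 - 2 * \<theta>) - 1" using \<theta> by (intro ln_le_minus_one) auto
    also have "\<dots> \<le> 4 * \<theta>"
    proof -
      have "0 \<le> 2 * \<theta> * (1 - 4 * \<theta>)" using \<theta> by (intro mult_nonneg_nonneg) auto
      then have "1 \<le> (1 + 4 * \<theta>) * (1 - 2 * \<theta>)" by (simp add: algebra_simps)
      then have "1 / (1 - 2 * \<theta>) \<le> 1 + 4 * \<theta>" using \<theta> by (simp add: pos_divide_le_eq)
      then show ?thesis by simp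
    qed
    finally show ?thesis using \<theta> r0 by (simp add: P_def ln_div)
  qed
  have lnP2: "- ln P \<le> L"
  proof -
    have "1 / (2 * real r) = (1 / 2) / r" by simp
    also have "\<dots> \<le> P" unfolding P_def using \<theta> r0 by (intro divide_right_mono) auto
    finally have "ln (1 / (2 * real r)) \<le> ln P" using r0 by (intro ln_mono) auto
    then show ?thesis using L(2) r0 by (simp add: ln_div)
  qed
  define z\<^sub>0 where "z\<^sub>0 = root d (2 ^ 18 * (\<mu> * L\<^sup>2))"
  have z0: "z\<^sub>0 ^ d = 2 ^ 18 * (\<mu> * L\<^sup>2)" "0 < z\<^sub>0"
    using d \<mu> L unfolding z\<^sub>0_def by auto
  define C where "C = 12 * real m * real r * (real d)\<^sup>2"
  have C0: "0 \<le> C" by (simp add: C_def)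
  have Cz0: "C * z\<^sub>0 \<le> \<mu> * L / 32"
  proof -
    \<comment> \<open>Here 768 = 12 * 2 * 32: the 12 from \<open>C\<close>, the 2 from
      \<open>m \<le> 2 * L\<close>, and the 32 from the claim.\<close>
    have "(768 * real r * (real d)\<^sup>2 * z\<^sub>0) ^ d = 2 ^ 18 * (\<mu> * L\<^sup>2) * (768 * real r * (real d)\<^sup>2) ^ d"
      unfolding power_mult_distrib[of _ z\<^sub>0] z0(1) by (rule mult.commute)
    also have "\<dots> \<le> \<mu> ^ d" by (rule \<mu>2)
    finally have "768 * real r * (real d)\<^sup>2 * z\<^sub>0 \<le> \<mu>"
      using d \<mu> z0 by (subst (asm) power_mono_iff) auto
    then have a: "L * (768 * real r * (real d)\<^sup>2 * z\<^sub>0) \<le> L * \<mu>" using L by (intro mult_left_mono) auto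
    have "C * z\<^sub>0 = m * (12 * real r * (real d)\<^sup>2 * z\<^sub>0)" by (simp add: C_def)
    also have "\<dots> \<le> 2 * L * (12 * real r * (real d)\<^sup>2 * z\<^sub>0)"
      using m(2) z0 by (intro mult_right_mono) auto
    also have "\<dots> = L * (768 * real r * (real d)\<^sup>2 * z\<^sub>0) / 32" by simp
    finally show ?thesis using a by (simp add: mult_ac)
  qed
  define B where "B = \<mu> * t / 512"
  define D where "D = 4 * t * L / z\<^sub>0 ^ d"
  have BD: "0 \<le> B" "0 \<le> D" using \<mu> L z0 by (auto simp: B_def D_def)
  have D25: "D * (25 * L) \<le> t / (2048 * \<mu>)"
  proof -
    have "D * (25 * L) = 100 / 2 ^ 18 * (t / \<mu>)"
      unfolding D_def z0(1) using \<mu> L by (simp add: power2_eq_square field_simps)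
    also have "\<dots> \<le> 1 / 2048 * (t / \<mu>)" using \<mu> by (intro mult_right_mono) auto
    finally show ?thesis by simp
  qed
  \<comment> \<open>The excess remaining after \<open>t\<close> colour steps without any boost, by
    \<open>one_minus_inverse_power\<close>.\<close>
  define \<delta>' where "\<delta>' = \<delta> * exp (- 2)"
  define Q where "Q = - ln P + 2 * D / t"
  define A where "A = ln (2 * real r) + C * z\<^sub>0 + 2 * B / t"
  define M where "M = ln (card W) - (t * Q - D * ln \<delta>)"
  have e9: "t / \<delta>' \<le> 2 ^ 17 * real r * \<mu> * t"
  proof -
    have "exp 2 = exp 1 * exp (1::real)" by (simp flip: exp_add)
    also have "\<dots> \<le> 3 * 3" using exp_le by (intro mult_mono) auto
    finally have "exp (2::real) \<le> 16" by simp
    then have "(8192 * real r * \<mu> * t) * exp 2 \<le> (8192 * real r * \<mu> * t) * 16"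
      using \<mu> by (intro mult_left_mono) auto
    moreover have "t / \<delta>' = (8192 * real r * \<mu> * t) * exp 2"
      by (simp add: \<delta>'_def \<delta>_def \<theta>_def exp_minus field_simps)
    ultimately show ?thesis by simp
  qed
  \<comment> \<open>The run starts with \<open>X\<close> and all \<open>Y i\<close> equal to
    \<open>W\<close> and asks for \<open>t\<close> vertices in every colour.\<close>
  have "\<exists>j<r. \<exists>Y'\<subseteq>W. Y' \<noteq> {} \<and> clique_free j Y' (\<kappa> j - t) \<and> M \<le> ln (card Y')"
  proof (rule book[where Y = "\<lambda>_. W" and n = "\<lambda>_. t" and a = "\<lambda>_. \<delta>" and X = W and t = "real t"
        and P = P and \<delta> = \<delta>' and D = D and B = B and z\<^sub>0 = z\<^sub>0 and A = A and Q = Q and d = d and m = m,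
        folded C_def])
    show "C * z \<le> B * ln (1 + (z ^ d - 2) / real t)" if "z\<^sub>0 < z" "z ^ d - 2 \<le> real t / \<delta>'" for z
      unfolding B_def
      by (rule boost_cost[OF z0 that(1) C0 Cz0 L(1) _ d _ _ _ t(2)]) (use \<mu> t2 r2 that e9 in auto)
    show "- ln P \<le> D * ln (1 + (z ^ d - 2) / real t)" if "z\<^sub>0 < z" for z
      using boost_density[of z\<^sub>0 d "real t" z L] z0 \<mu>L t(1) that L lnP2 unfolding D_def by simp
    show "A * (\<Sum>i<r. real t) - B * (\<Sum>i<r. ln \<delta>) \<le> ln (card W)"
    proof -
      have "t * A - B * ln \<delta> \<le> \<mu> * t * L / 8"
      proof -
        have "2 * B / t = \<mu> / 256" using t2 by (simp add: B_def)
        moreover have "\<mu> * 2 \<le> \<mu> * L" using L \<mu> by (intro mult_left_mono) auto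
        moreover have "512 * L \<le> \<mu> * L" using L \<mu> by (intro mult_right_mono) auto
        \<comment> \<open>The three parts of \<open>A\<close> cost 1, 16 and 1 units of
          \<open>\<mu> * L / 512\<close>; the initial excess costs 24 more, and 64 are
          available.\<close>
        ultimately have "A \<le> 18 / 512 * (\<mu> * L)" using L(2) Cz0 L(1) unfolding A_def by linarith
        then have 1: "t * A \<le> t * (18 / 512 * (\<mu> * L))" by (intro mult_left_mono) auto
        have "B * (- ln \<delta>) \<le> B * (24 * L)" using ln\<delta> BD by (intro mult_left_mono) auto
        also have "\<dots> = t * (24 / 512 * (\<mu> * L))" by (simp add: B_def)
        finally have "t * A - B * ln \<delta> \<le> 42 / 512 * (t * (\<mu> * L))" using 1 by simp
        also have "\<dots> \<le> 64 / 512 * (t * (\<mu> * L))" using \<mu> L by (intro mult_right_mono) auto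
        finally show ?thesis by (simp add: mult_ac)
      qed
      then have "r * (t * A - B * ln \<delta>) \<le> r * (\<mu> * t * L / 8)" by (intro mult_left_mono) auto
      then show ?thesis using W(3) by (simp add: algebra_simps)
    qed
    show "\<delta>' \<le> \<delta> * (1 - 1 / real t) ^ t"
      unfolding \<delta>'_def using \<delta> one_minus_inverse_power[of t] t2 by (intro mult_left_mono) auto
    show "clique_free i (W \<union> W) (\<kappa> i - t + t)" if "i < r" for i using free[OF that] by simp
  qed (use d m P t2 \<delta> BD z0 \<mu>L W deg P\<delta> in \<open>auto simp: \<delta>'_def Q_def A_def M_def\<close>)
  moreover have "ln (card W) - t * ln r - t / (1024 * \<mu>) \<le> M"
  proof -
    have "t * Q = t * (- ln P) + 2 * D" using t2 by (simp add: Q_def field_simps)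
    also have "\<dots> \<le> t * (ln r + 4 * \<theta>) + 2 * D" using lnP by (intro add_right_mono mult_left_mono) auto
    also have "\<dots> = t * ln r + t / (2048 * \<mu>) + 2 * D" by (simp add: \<theta>_def algebra_simps)
    finally have tQ: "t * Q \<le> t * ln r + t / (2048 * \<mu>) + 2 * D" .
    have "D * (- ln \<delta>) \<le> D * (24 * L)" using ln\<delta> BD by (intro mult_left_mono) auto
    moreover have "D * 2 \<le> D * L" using L BD by (intro mult_left_mono) auto
    ultimately have "2 * D - D * ln \<delta> \<le> D * (25 * L)" by simp
    then show ?thesis using tQ D25 unfolding M_def by (simp add: field_simps)
  qed
  ultimately show ?thesis by (meson order_trans)
qed

end

section \<open>The bound for a single colouring\<close>

context edge_coloring
begin

text \<open>By contradiction from a set \<open>V\<close> that is too large. Many degree reductions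
  would violate the diagonal bound. After few, all colour degrees are close to
  \<open>card W / r\<close>, and \<open>book_application\<close> with \<open>t\<close> about
  \<open>k / \<mu>\<close> produces \<open>Y\<close>; then \<open>W\<close> or \<open>Y\<close>
  violates the deviation bound.\<close>

lemma coloring_bound:
  fixes \<mu> L :: real and d m k :: nat
  assumes r2: "2 \<le> r" and d: "3 \<le> d" and m: "4 * real r + 2 \<le> 4 ^ m" "m \<le> 2 * L"
    and L: "2 \<le> L" "ln (2 * real r) \<le> L" "L \<le> 4 * ln r"
    and \<mu>1: "2 ^ 28 * real r \<le> \<mu>"
    and \<mu>2: "2 ^ 18 * (\<mu> * L\<^sup>2) * (768 * real r * (real d)\<^sup>2) ^ d \<le> \<mu> ^ d"
    and \<mu>3: "ln (8192 * real r * \<mu>) \<le> 24 * L"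
    and k: "2 ^ 20 * (\<mu> * (\<mu> * L\<^sup>2)) \<le> k"
    and V: "finite V" "\<And>i. i < r \<Longrightarrow> clique_free i V k"
  shows "real (card V) + 1 \<le> exp (- (k / (4096 * \<mu>\<^sup>2))) * real r ^ (r * k)"
proof (rule ccontr)
  define \<eta> where "\<eta> = k / (4096 * \<mu>\<^sup>2)"
  assume "\<not> ?thesis"
  then have big: "exp (- \<eta>) * real r ^ (r * k) < real (card V) + 1" by (simp add: \<eta>_def)
  have rr: "2 \<le> real r" using r2 by simp
  then have \<mu>: "2 ^ 29 \<le> \<mu>" "0 < \<mu>" using \<mu>1 by simp_all
  have L2: "4 \<le> L\<^sup>2" "L \<le> L\<^sup>2" using L power_mono[of 2 L 2] power_increasing[of 1 2 L] by simp_all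
  have \<mu>L: "4 \<le> \<mu> * L\<^sup>2" "r * L \<le> \<mu> * L\<^sup>2"
    using mult_mono[of 1 \<mu> 4 "L\<^sup>2"] mult_mono[of r \<mu> L "L\<^sup>2"] \<mu> \<mu>1 L L2 by simp_all
  define T where "T = k / \<mu>"
  have kT: "k = T * \<mu>" using \<mu> by (simp add: T_def)
  have T: "2 ^ 20 * (\<mu> * L\<^sup>2) \<le> T" using k \<mu> by (simp add: T_def pos_le_divide_eq mult_ac)
  have T0: "4194304 \<le> T" using T \<mu>L by simp
  have \<eta>: "\<eta> = T / (4096 * \<mu>)" using \<mu> by (simp add: \<eta>_def T_def power2_eq_square)
  have T8: "8 * T \<le> k"
  proof -
    have "T * 8 \<le> T * \<mu>" using T0 \<mu> by (intro mult_left_mono) auto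
    then show ?thesis by (simp add: kT)
  qed
  have \<eta>1: "1 \<le> \<eta>"
  proof -
    have "\<mu> * 4 \<le> \<mu> * L\<^sup>2" using \<mu> L2 by (intro mult_left_mono) auto
    moreover have "1048576 * (\<mu> * L\<^sup>2) \<le> T" using T by simp
    ultimately have "4096 * \<mu> \<le> T" using \<mu>(2) by linarith
    then show ?thesis using \<mu> by (simp add: \<eta>)
  qed
  have \<eta>k: "4096 * \<eta> \<le> T"
  proof -
    have "T / \<mu> \<le> T / 1" using \<mu> T0 by (intro divide_left_mono) auto
    then show ?thesis by (simp add: \<eta>)
  qed
  have lnr: "1 / 2 \<le> ln r" using L by linarith
  have rkl: "k \<le> r * k * ln r"
  proof -
    have "2 * (1 / 2) \<le> real r * ln r" using rr lnr by (intro mult_mono) auto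
    then have "real k * 1 \<le> real k * (real r * ln r)" by (intro mult_left_mono) auto
    then show ?thesis by (simp add: mult_ac)
  qed
  have r0: "0 < real r" using rr by linarith
  \<comment> \<open>Halving absorbs the \<open>+ 1\<close> and costs \<open>ln 2\<close>, which is
    below \<eta>.\<close>
  have lnV: "r * k * ln r - 2 * \<eta> \<le> ln (card V)"
  proof -
    define b where "b = exp (r * k * ln r - \<eta>)"
    have "real r ^ (r * k) = exp (r * k * ln r)"
      using r0 by (simp add: exp_of_nat_mult flip: of_nat_mult)
    then have b: "b < real (card V) + 1" using big by (simp add: b_def exp_diff exp_minus field_simps)
    have "1 \<le> r * k * ln r - \<eta>" using rkl T8 \<eta>k T0 by linarith
    then have "exp 1 \<le> b" by (simp add: b_def)
    then have b2: "2 \<le> b" using exp_ge_add_one_self[of "1::real"] by linarith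
    then have "ln (b / 2) \<le> ln (card V)" using b by (intro ln_mono) auto
    moreover have "ln (b / 2) = r * k * ln r - \<eta> - ln 2" by (simp add: ln_div b_def)
    moreover have "ln 2 \<le> (1::real)" using ln_le_minus_one[of "2::real"] by simp
    ultimately show ?thesis using \<eta>1 by linarith
  qed
  have cV: "0 < card V"
  proof (rule ccontr)
    assume "\<not> 0 < card V"
    then have "r * k * ln r - 2 * \<eta> \<le> 0" using lnV by simp
    then show False using rkl T8 \<eta>k T0 by linarith
  qed
  define \<theta> where "\<theta> = 1 / (8192 * \<mu>)"
  have \<theta>: "0 < \<theta>" "\<theta> \<le> 1" using \<mu> by (auto simp: \<theta>_def)
  \<comment> \<open>If \<open>r - 1\<close> colours have degree at most (1 + \<epsilon>) / r, the
    last one has at least (1 - \<theta>) / r, with \<open>\<theta> / r\<^sup>2\<close> to spare.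
    \<open>cWbig\<close> makes that spare part of \<open>W\<close> at least one vertex, namely the
    one not adjacent to itself.\<close>
  define \<epsilon> where "\<epsilon> = \<theta> / r"
  have \<epsilon>: "0 < \<epsilon>" "\<epsilon> \<le> 1" using \<theta> rr by (auto simp: \<epsilon>_def field_simps)
  define g where "g = (1 + \<epsilon>) / r"
  have g: "0 < g" using \<epsilon> r0 by (simp add: g_def)
  obtain s \<kappa> W where s: "s \<le> k div 2" and W: "W \<subseteq> V" "\<And>i. i < r \<Longrightarrow> clique_free i W (\<kappa> i)"
    and \<kappa>: "(\<Sum>i<r. \<kappa> i) + s = r * k" "\<And>i. i < r \<Longrightarrow> \<kappa> i \<le> k"
    and cW: "g ^ s * card V \<le> card W"
    and alt: "s = k div 2 \<or> (\<forall>v\<in>W. \<forall>i<r. card (nb i v W) < g * card W)"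
    using degree_reduction[OF V less_imp_le[OF g], of "k div 2"] by blast
  have finW: "finite W" using W(1) V(1) finite_subset by blast
  have gV: "0 < g ^ s * card V" using g cV by simp
  then have cW0: "0 < card W" using cW by linarith
  then have Wne: "W \<noteq> {}" by auto
  define N where "N = real (\<Sum>i<r. \<kappa> i)"
  have "N + real s = real (r * k)" unfolding N_def by (metis \<kappa>(1) of_nat_add)
  then have N: "N = real (r * k) - real s" by simp
  have lnW: "N * ln r - 2 * \<eta> + s * ln (1 + \<epsilon>) \<le> ln (card W)"
  proof -
    have "ln (g ^ s * card V) = s * (ln (1 + \<epsilon>) - ln r) + ln (card V)"
      using g cV \<epsilon> r0 by (simp add: ln_mult_pos ln_realpow) (simp add: g_def ln_div)
    moreover have "ln (g ^ s * card V) \<le> ln (card W)" using cW gV by (intro ln_mono) auto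
    ultimately show ?thesis using lnV by (simp add: N algebra_simps)
  qed
  have s2: "2 * real s \<le> k" using s by linarith
  have N34: "3 / 4 * (r * k) \<le> N"
  proof -
    have "2 * real k \<le> real r * k" using rr by (intro mult_right_mono) auto
    then show ?thesis using s2 unfolding N of_nat_mult by linarith
  qed
  have q\<epsilon>: "0 \<le> s * ln (1 + \<epsilon>)" using \<epsilon> by simp
  \<comment> \<open>Each of the \<open>k div 2\<close> reductions gains at least \<epsilon> / 2;
    together they would exceed 2 \<eta>, since \<mu> is larger than 32 r.\<close>
  have ne: "s \<noteq> k div 2"
  proof
    assume sk: "s = k div 2"
    have "s * ln (1 + \<epsilon>) \<le> 2 * \<eta>"
      using lnW erdos_szekeres_diagonal[OF r2 finW W(2) Wne] by (simp add: N_def)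
    moreover have "k / 4 * (\<epsilon> / 2) \<le> s * ln (1 + \<epsilon>)"
    proof (rule mult_mono)
      show "real k / 4 \<le> s" using sk T8 T0 by linarith
      show "\<epsilon> / 2 \<le> ln (1 + \<epsilon>)" using \<epsilon> by (intro half_le_ln_one_plus) auto
    qed (use \<epsilon> in auto)
    ultimately have "k / 4 * (\<epsilon> / 2) \<le> 2 * \<eta>" by linarith
    then have "T / (65536 * r) \<le> T / (2048 * \<mu>)" using \<mu> by (simp add: \<epsilon>_def \<theta>_def \<eta> kT)
    then have "\<mu> \<le> 32 * r" using T0 r0 \<mu> by (simp add: field_simps)
    then show False using \<mu>1 r0 by simp
  qed
  then have deg: "card (nb i v W) < g * card W" if "v \<in> W" "i < r" for i v using alt that by blast
  have lnWbig: "r * k * L / 8 \<le> ln (card W)"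
  proof -
    have "real (r * k) * L \<le> real (r * k) * (4 * ln r)" using L(3) by (intro mult_left_mono) auto
    then have "real (r * k) * L \<le> 4 * (real (r * k) * ln r)" by simp
    moreover have "3 / 4 * (r * k) * ln r \<le> N * ln r" using N34 lnr by (intro mult_right_mono) auto
    then have "3 / 4 * (real (r * k) * ln r) \<le> N * ln r" by simp
    ultimately show ?thesis using lnW q\<epsilon> rkl \<eta>k T8 T0 by linarith
  qed
  have cWbig: "8192 * \<mu> * r\<^sup>2 \<le> card W"
  proof -
    have "ln (8192 * \<mu> * r\<^sup>2) = ln (8192 * real r * \<mu>) + ln r"
      using ln_mult_pos[of "8192 * real r * \<mu>" "real r"] r0 \<mu> by (simp add: power2_eq_square mult_ac)
    also have "\<dots> \<le> 25 * L" using \<mu>3 L(2) ln_mono[of "real r" "2 * real r"] r0 by linarith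
    also have "\<dots> \<le> r * k / 8 * L"
    proof (rule mult_right_mono)
      have "2 * real k \<le> real r * k" using rr by (intro mult_right_mono) auto
      then show "25 \<le> real (r * k) / 8" using T8 T0 unfolding of_nat_mult by linarith
    qed (use L in auto)
    also have "\<dots> \<le> ln (card W)" using lnWbig by simp
    finally show ?thesis using \<mu> r0 cW0 by (subst (asm) ln_le_cancel_iff) auto
  qed
  have deg': "(1 - 1 / (8192 * \<mu>)) / r * card W \<le> card (nb i v W)" if i: "i < r" and v: "v \<in> W" for i v
  proof -
    have "real (card W) - 1 = (\<Sum>l<r. real (card (nb l v W)))"
      using sum_card_nb[OF finW, of v] v finW cW0 by (simp flip: of_nat_sum)
    also have "\<dots> = card (nb i v W) + (\<Sum>l\<in>{..<r}-{i}. real (card (nb l v W)))"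
      using i by (intro sum.remove) auto
    also have "(\<Sum>l\<in>{..<r}-{i}. real (card (nb l v W))) \<le> (\<Sum>l\<in>{..<r}-{i}. g * card W)"
      using deg[OF v] by (intro sum_mono) (auto simp: less_imp_le)
    also have "\<dots> = (real r - 1) * g * card W" using i by (simp add: of_nat_diff)
    finally have a: "real (card W) - 1 \<le> card (nb i v W) + (real r - 1) * g * card W" by simp
    have "\<theta> / (real r)\<^sup>2 * (8192 * \<mu> * (real r)\<^sup>2) \<le> \<theta> / (real r)\<^sup>2 * card W"
      using cWbig \<theta> by (intro mult_left_mono) auto
    moreover have "\<theta> / (real r)\<^sup>2 * (8192 * \<mu> * (real r)\<^sup>2) = 1" using \<mu> r0 by (simp add: \<theta>_def)
    moreover have "\<theta> / (real r)\<^sup>2 = 1 - (real r - 1) * g - (1 - \<theta>) / r"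
      using r0 by (simp add: g_def \<epsilon>_def power2_eq_square field_simps)
    ultimately have "1 \<le> (1 - (real r - 1) * g - (1 - \<theta>) / r) * card W" by simp
    then show ?thesis using a by (simp add: \<theta>_def algebra_simps)
  qed
  define t where "t = nat \<lfloor>T\<rfloor>"
  have t: "real t \<le> T" "T / 2 \<le> t" using T0 unfolding t_def by linarith+
  have t18: "2 ^ 18 * (\<mu> * L\<^sup>2) \<le> t" using t T \<mu>L by simp
  have t15: "2 ^ 15 * real r * L \<le> (real t)\<^sup>2"
  proof -
    have "real t \<le> (real t)\<^sup>2" using t T0 power_increasing[of 1 2 "real t"] by (simp del: of_nat_power)
    moreover have "262144 * (\<mu> * L\<^sup>2) \<le> real t" using t18 by simp
    ultimately have "32768 * (real r * L) \<le> (real t)\<^sup>2" using \<mu>L by linarith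
    then show ?thesis by simp
  qed
  have Wln: "r * \<mu> * t * L / 8 \<le> ln (card W)"
  proof -
    have "t * \<mu> \<le> k" using t \<mu> by (simp add: kT)
    then have "r * L * (t * \<mu>) \<le> r * L * k" using L by (intro mult_left_mono) auto
    then show ?thesis using lnWbig by (simp add: mult_ac)
  qed
  have \<kappa>k: "real k / 2 \<le> \<kappa> i" if "i < r" for i
  proof -
    have "(\<Sum>l<r. real (\<kappa> l)) = \<kappa> i + (\<Sum>l\<in>{..<r}-{i}. real (\<kappa> l))"
      using that by (intro sum.remove) auto
    also have "(\<Sum>l\<in>{..<r}-{i}. real (\<kappa> l)) \<le> (\<Sum>l\<in>{..<r}-{i}. real k)"
      using \<kappa>(2) by (intro sum_mono) auto
    also have "\<dots> = (real r - 1) * k" using that by (simp add: of_nat_diff)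
    finally have "N \<le> \<kappa> i + (real r - 1) * k" by (simp add: N_def)
    then show ?thesis using s2 by (simp add: N algebra_simps)
  qed
  have t\<kappa>: "t \<le> \<kappa> i" if "i < r" for i
  proof -
    have "real t \<le> \<kappa> i" using \<kappa>k[OF that] t T8 T0 by linarith
    then show ?thesis by simp
  qed
  obtain j Y where j: "j < r" and Y: "Y \<subseteq> W" "Y \<noteq> {}" "clique_free j Y (\<kappa> j - t)"
    and lnY: "ln (card W) - t * ln r - t / (1024 * \<mu>) \<le> ln (card Y)"
    using book_application[OF r2 d m L(1,2) \<mu>1 \<mu>2 \<mu>3 t18 t15 finW Wne Wln deg' W(2) t\<kappa>] by blast
  define \<kappa>' where "\<kappa>' = \<kappa>(j := \<kappa> j - t)"
  have free': "clique_free i Y (\<kappa>' i)" if "i < r" for i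
    using that Y(1,3) W(2)[OF that] by (auto simp: \<kappa>'_def intro: clique_free_subset)
  have N': "(\<Sum>i<r. real (\<kappa>' i)) = N - t"
    using sum_fun_upd[of "{..<r}" j "\<lambda>i v. real v" \<kappa> "\<kappa> j - t"] j t\<kappa>[OF j]
    by (simp add: \<kappa>'_def N_def of_nat_diff)
  \<comment> \<open>Rounding loses at most a factor 2 in \<open>t\<close>, so k \<le> 2 t \<mu>, and
    256 = 16 * 8 * 2.\<close>
  have gain: "t / (256 * \<mu>) \<le> x\<^sup>2 / (8 * a)" if "0 < a" "a \<le> k" "(real t)\<^sup>2 / 16 \<le> x\<^sup>2" for a x :: real
  proof -
    have "t / (256 * \<mu>) = (real t)\<^sup>2 / 16 / (8 * (2 * t * \<mu>))"
      using t T0 \<mu> by (simp add: power2_eq_square)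
    also have "\<dots> \<le> (real t)\<^sup>2 / 16 / (8 * a)"
    proof -
      have "T * \<mu> \<le> 2 * t * \<mu>" using t \<mu> by (intro mult_right_mono) auto
      then have "8 * a \<le> 8 * (2 * t * \<mu>)" using that unfolding kT by linarith
      then show ?thesis using that by (intro frac_le) simp_all
    qed
    also have "\<dots> \<le> x\<^sup>2 / (8 * a)" using that by (intro divide_right_mono) auto
    finally show ?thesis .
  qed
  have tr: "real t / r \<le> k / 8"
  proof -
    have "real t / r \<le> t / 1" using rr by (intro divide_left_mono) auto
    then show ?thesis using t T8 by linarith
  qed
  have avg: "3 / 4 * k \<le> N / r" "N / r \<le> k"
    using N34 r0 by (auto simp: N field_simps)
  have avg': "k / 3 \<le> (N - t) / r" "(N - t) / r \<le> k" "0 < real k"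
  proof -
    show k0: "0 < real k" using T8 T0 by linarith
    have "0 \<le> real t / r" by simp
    then show "k / 3 \<le> (N - t) / r" "(N - t) / r \<le> k"
      unfolding diff_divide_distrib using avg tr k0 by linarith+
  qed
  \<comment> \<open>Lowering one size by \<open>t\<close> lowers the average by \<open>t / r\<close>
    only, so the deviation of colour \<open>j\<close> moves by at least
    \<open>t / 2\<close>.\<close>
  have far: "t / 2 \<le> \<bar>(\<kappa> j - N / r) - (real (\<kappa> j - t) - (N - t) / r)\<bar>"
  proof -
    have "real t / r \<le> t / 2" using rr by (intro divide_left_mono) auto
    then show ?thesis
      unfolding of_nat_diff[OF t\<kappa>[OF j]] diff_divide_distrib by linarith
  qed
  have \<eta>t: "2 * \<eta> \<le> t / (1024 * \<mu>)"
  proof -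
    have "T / (2048 * \<mu>) \<le> (2 * t) / (2048 * \<mu>)" using t \<mu> by (intro divide_right_mono) auto
    then show ?thesis by (simp add: \<eta>)
  qed
  \<comment> \<open>In units of \<open>q / 1024\<close> the two possible losses are one each,
    against a gain of four.\<close>
  define q where "q = t / \<mu>"
  have q: "0 < q" "t / (1024 * \<mu>) = q / 1024" "t / (256 * \<mu>) = q / 256"
    using t T0 \<mu> by (auto simp: q_def)
  consider "(real t)\<^sup>2 / 16 \<le> (\<kappa> j - N / r)\<^sup>2" | "(real t)\<^sup>2 / 16 \<le> (real (\<kappa> j - t) - (N - t) / r)\<^sup>2"
    using square_large_of_far_apart[OF far] by auto
  then show False
  proof cases
    case 1
    have "ln (card W) \<le> N * ln r - (\<kappa> j - N / r)\<^sup>2 / (8 * (N / r))"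
    proof -
      have "\<kappa> i \<le> 3 * (N / r)" if "i < r" for i using \<kappa>(2)[OF that] avg by linarith
      then show ?thesis
        using erdos_szekeres_deviation[OF r2 finW W(2) Wne _ j] by (simp add: N_def)
    qed
    moreover have "t / (256 * \<mu>) \<le> (\<kappa> j - N / r)\<^sup>2 / (8 * (N / r))"
      using avg avg'(3) 1 by (intro gain; linarith)
    ultimately show False using lnW q\<epsilon> \<eta>t q by linarith
  next
    case 2
    have "ln (card Y) \<le> (N - t) * ln r - (real (\<kappa>' j) - (N - t) / r)\<^sup>2 / (8 * ((N - t) / r))"
    proof -
      have "\<kappa>' i \<le> 3 * ((N - t) / r)" if "i < r" for i
      proof -
        have "\<kappa>' i \<le> k" using \<kappa>(2)[OF that] by (auto simp: \<kappa>'_def)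
        then show ?thesis using avg' by linarith
      qed
      moreover have "real (\<Sum>i<r. \<kappa>' i) = N - t" using N' by simp
      ultimately show ?thesis
        using erdos_szekeres_deviation[OF r2 finite_subset[OF Y(1) finW] free' Y(2) _ j]
        by (simp add: N')
    qed
    moreover have "t / (256 * \<mu>) \<le> (real (\<kappa>' j) - (N - t) / r)\<^sup>2 / (8 * ((N - t) / r))"
      using avg' 2 unfolding \<kappa>'_def fun_upd_same by (intro gain; linarith)
    moreover have "(N - t) * ln r = N * ln r - t * ln r" by (rule left_diff_distrib)
    ultimately show False using lnW lnY q\<epsilon> \<eta>t q by linarith
  qed
qed

end

section \<open>Admissible parameters and exponents\<close>

text \<open>\<mu> is the solution of \<open>\<mu> powr (d - 1) = b ^ d * L\<^sup>2\<close>, which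
  makes the second condition hold by the choice of \<open>b\<close>. Its square is then, up to the
  constant, the denominator in the theorem.\<close>

lemma parameter_exists:
  fixes r d :: nat
  defines "L \<equiv> ln (2 * real r * real d)"
  assumes r: "2 \<le> r" and d: "3 \<le> d" and L3: "2 \<le> L" "3 * ln 2 \<le> L"
  obtains \<mu> where "2 ^ 28 * real r \<le> \<mu>"
    "2 ^ 18 * (\<mu> * L\<^sup>2) * (768 * real r * (real d)\<^sup>2) ^ d \<le> \<mu> ^ d"
    "ln (8192 * real r * \<mu>) \<le> 24 * L"
    "\<mu>\<^sup>2 \<le> 2 ^ 84 * (real r powr (2 * real d / (real d - 1)) * real d powr (4 * real d / (real d - 1))
        * L powr (4 / (real d - 1)))"
proof -
  define D where "D = real d"
  define e where "e = D / (D - 1)"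
  define f where "f = 2 / (D - 1)"
  define b where "b = 2 ^ 28 * real r * D\<^sup>2"
  define \<mu> where "\<mu> = b powr e * L powr f"
  have D: "3 \<le> D" using d by (simp add: D_def)
  have r0: "2 \<le> real r" using r by simp
  have e: "1 \<le> e" "e \<le> 3 / 2" "e * (D - 1) = D" using D by (auto simp: e_def field_simps)
  have f: "0 \<le> f" "f \<le> 1" "f * (D - 1) = 2" using D by (auto simp: f_def field_simps)
  have "1 * 1 \<le> D * D" using D by (intro mult_mono) auto
  then have "2 ^ 28 * real r * 1 \<le> b" unfolding b_def power2_eq_square
    using r0 by (intro mult_left_mono) auto
  then have b: "2 ^ 28 * real r \<le> b" "1 \<le> b" "0 < b" using r0 by simp_all
  have "b powr 1 * 1 \<le> b powr e * L powr f"
  proof (rule mult_mono)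
    show "b powr 1 \<le> b powr e" using e b by (intro powr_mono) auto
    show "1 \<le> L powr f" using L3 f by (intro ge_one_powr_ge_zero) auto
  qed auto
  then have b\<mu>: "b \<le> \<mu>" using b by (simp add: \<mu>_def)
  then have \<mu>0: "0 < \<mu>" using b by linarith
  show ?thesis
  proof
    show "2 ^ 28 * real r \<le> \<mu>" using b(1) b\<mu> by linarith
    have "\<mu> powr (D - 1) = b powr D * L powr 2"
      using b L3 by (simp add: \<mu>_def powr_mult powr_powr e(3) f(3))
    also have "\<dots> = b ^ d * L\<^sup>2" using b L3 by (simp add: D_def powr_realpow)
    finally have p: "\<mu> powr (D - 1) = b ^ d * L\<^sup>2" .
    have "\<mu> ^ d = \<mu> powr (1 + (D - 1))" using \<mu>0 by (simp add: D_def powr_realpow)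
    also have "\<dots> = \<mu> * (b ^ d * L\<^sup>2)" using \<mu>0 unfolding powr_add p by simp
    finally have \<mu>d: "\<mu> ^ d = \<mu> * L\<^sup>2 * b ^ d" by simp
    \<comment> \<open>The constant is moved into the d-th power, where 2^18 * 768 is below the 2^28
      in \<open>b\<close>.\<close>
    have "2 ^ 18 * (768 * real r * D\<^sup>2) ^ d \<le> (2 ^ 18) ^ d * (768 * real r * D\<^sup>2) ^ d"
      using d power_increasing[of 1 d "2 ^ 18 :: real"] by (intro mult_right_mono) auto
    also have "\<dots> = (2 ^ 18 * 768 * (real r * D\<^sup>2)) ^ d" by (simp only: power_mult_distrib[symmetric] mult.assoc)
    also have "\<dots> \<le> b ^ d"
      unfolding b_def mult.assoc[of _ "real r"] by (intro power_mono mult_right_mono) auto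
    finally have "\<mu> * L\<^sup>2 * (2 ^ 18 * (768 * real r * D\<^sup>2) ^ d) \<le> \<mu> * L\<^sup>2 * b ^ d"
      using \<mu>0 by (intro mult_left_mono) auto
    then show "2 ^ 18 * (\<mu> * L\<^sup>2) * (768 * real r * (real d)\<^sup>2) ^ d \<le> \<mu> ^ d"
      by (simp add: \<mu>d D_def mult_ac)
  next
    have Lsum: "L = ln 2 + ln r + ln D" using r0 D unfolding L_def D_def by (simp add: ln_mult_pos)
    have lnb: "ln b = 28 * ln 2 + ln r + 2 * ln D"
    proof -
      have "ln (2 ^ 28 :: real) = 28 * ln 2" using ln_realpow[of 2 28] by simp
      then show ?thesis using r0 D by (simp add: b_def ln_mult_pos ln_realpow)
    qed
    have ln\<mu>: "ln \<mu> = e * ln b + f * ln L" using b L3 by (simp add: \<mu>_def ln_mult_pos ln_powr)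
    have pos: "0 \<le> ln r" "0 \<le> ln D" "0 \<le> ln L" "0 \<le> ln (2::real)" using r0 D L3 by auto
    have "ln L \<le> L" using L3 ln_le_minus_one[of L] by linarith
    moreover have "f * ln L \<le> 1 * ln L" using f pos by (intro mult_right_mono) auto
    moreover have "e * ln b \<le> 3 / 2 * ln b" using e b by (intro mult_right_mono) auto
    moreover have "ln (8192 * real r * \<mu>) = 13 * ln 2 + ln r + ln \<mu>"
    proof -
      have "ln (8192 :: real) = 13 * ln 2" using ln_realpow[of 2 13] by simp
      then show ?thesis using r0 \<mu>0 by (simp add: ln_mult_pos)
    qed
    \<comment> \<open>Since L = ln 2 + ln r + ln D, the left side is at most 4 L + 52 ln 2, and 3 ln
      2 \<le> L.\<close>
    ultimately show "ln (8192 * real r * \<mu>) \<le> 24 * L"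
      using Lsum lnb ln\<mu> pos L3 by linarith
  next
    have "\<mu>\<^sup>2 = b powr (2 * e) * L powr (2 * f)"
      using b L3 by (simp add: \<mu>_def power_mult_distrib powr_power mult.commute)
    also have "b powr (2 * e) = (2 ^ 28) powr (2 * e) * real r powr (2 * e) * D powr (4 * e)"
    proof -
      have "(D\<^sup>2) powr (2 * e) = D powr (4 * e)"
        using D by (simp add: powr_powr flip: powr_numeral)
      then show ?thesis using D by (simp add: b_def powr_mult)
    qed
    also have "(2 ^ 28 :: real) powr (2 * e) \<le> (2 ^ 28) powr 3"
      using e by (intro powr_mono) auto
    also have "(2 ^ 28 :: real) powr 3 = 2 ^ 84" by (simp add: powr_numeral)
    finally have "\<mu>\<^sup>2 \<le> 2 ^ 84 * (real r powr (2 * e) * D powr (4 * e) * L powr (2 * f))"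
      by (simp add: mult_ac mult_left_mono mult_right_mono)
    then show "\<mu>\<^sup>2 \<le> 2 ^ 84 * (real r powr (2 * real d / (real d - 1)) * real d powr (4 * real d / (real d - 1))
        * L powr (4 / (real d - 1)))"
      by (simp add: e_def f_def D_def)
  qed
qed

text \<open>The upper bound on \<open>d\<close> serves the last claim, through
  \<open>2 * r * d \<le> r ^ 4\<close>: either \<open>d \<le> 3\<close>, or
  \<open>d \<le> ln (2 * r) \<le> r\<close>.\<close>

lemma log_bounds:
  fixes r d :: nat
  defines "L \<equiv> ln (2 * real r * real d)"
  assumes r: "2 \<le> r" and d: "3 \<le> d" and dr: "real d \<le> max 3 (ln (2 * real r))"
  shows "2 \<le> L" "3 * ln 2 \<le> L" "ln (2 * real r) \<le> L" "L \<le> 4 * ln r"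
proof -
  have rd: "2 \<le> real r" "3 \<le> real d" using r d by auto
  have 12: "12 \<le> 2 * real r * real d" using mult_mono[of 2 "real r" 3 "real d"] rd by (simp add: mult_ac)
  have "exp 2 = exp 1 * exp (1::real)" by (simp flip: exp_add)
  also have "\<dots> \<le> 3 * 3" using exp_le by (intro mult_mono) auto
  finally have "exp 2 \<le> 2 * real r * real d" using 12 by linarith
  then have "ln (exp 2) \<le> L" unfolding L_def by (intro ln_mono) auto
  then show "2 \<le> L" by simp
  have "ln 8 \<le> L" unfolding L_def by (rule ln_mono) (use 12 in linarith)+
  moreover have "ln (8::real) = 3 * ln 2" using ln_realpow[of 2 3] by simp
  ultimately show "3 * ln 2 \<le> L" by simp
  show "ln (2 * real r) \<le> L" unfolding L_def using rd by (intro ln_mono) auto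
  have "2 * real r * real d \<le> real r ^ 4"
  proof (cases "real d \<le> 3")
    case True
    have "2 * real r * real d \<le> real r * 8" using True rd by simp
    also have "\<dots> \<le> real r * real r ^ 3" using rd power_mono[of 2 "real r" 3] by (intro mult_left_mono) auto
    finally show ?thesis by (simp add: power_numeral_reduce)
  next
    case False
    then have "real d \<le> ln (2 * real r)" using dr by auto
    also have "\<dots> = ln 2 + ln r" using rd by (simp add: ln_mult_pos)
    also have "\<dots> \<le> real r" using ln_le_minus_one[of "2::real"] ln_le_minus_one[of "real r"] rd by simp
    finally have "2 * real r * real d \<le> 2 * real r * real r" using rd by (intro mult_left_mono) auto
    also have "\<dots> \<le> (real r * real r) * (real r * real r)"
      using rd mult_mono[of 2 "real r" 2 "real r"] by (simp only: mult.assoc[symmetric]) simp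
    finally show ?thesis by (simp add: power_numeral_reduce mult_ac)
  qed
  then have "L \<le> ln (real r ^ 4)" unfolding L_def using 12 by (intro ln_mono) auto
  then show "L \<le> 4 * ln r" using rd by (simp add: ln_realpow)
qed

lemma ex_power_of_4:
  fixes L :: real
  assumes "2 \<le> L" "4 * real r + 2 \<le> exp L"
  obtains m :: nat where "4 * real r + 2 \<le> 4 ^ m" "m \<le> 2 * L"
proof
  let ?m = "nat \<lceil>L\<rceil>"
  show "?m \<le> 2 * L" using assms by linarith
  have "exp L \<le> exp (real ?m)" using assms by simp
  also have "\<dots> = exp 1 ^ ?m" by (simp flip: exp_of_nat_mult)
  also have "\<dots> \<le> 4 ^ ?m" using exp_le by (intro power_mono) auto
  finally show "4 * real r + 2 \<le> 4 ^ ?m" using assms by linarith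
qed

text \<open>Over the denominator \<open>(d - 1)\<^sup>2\<close> the exponents of r, d and L in
  \<open>\<mu>\<^sup>2 * L\<^sup>2\<close> have numerators \<open>2 * d\<^sup>2 - 2 * d\<close>,
  \<open>4 * d\<^sup>2 - 4 * d\<close> and \<open>2 * d\<^sup>2 - 2\<close>, none above the given
  ones, and all bases are at least 1. The constant is 2^20 * 2^84.\<close>

lemma size_bound:
  fixes r d :: nat and k L \<mu> :: real
  assumes r: "2 \<le> r" and d: "3 \<le> d" and L: "2 \<le> L"
    and \<mu>: "\<mu>\<^sup>2 \<le> 2 ^ 84 * (real r powr (2 * real d / (real d - 1))
        * real d powr (4 * real d / (real d - 1)) * L powr (4 / (real d - 1)))"
    and k: "2 ^ 104 * real r powr ((2 * (real d)\<^sup>2 - 1) / (real d - 1)\<^sup>2)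
               * real d powr (2 * real d * (2 * real d - 1) / (real d - 1)\<^sup>2)
               * L powr (2 * (real d)\<^sup>2 / (real d - 1)\<^sup>2) \<le> k"
  shows "2 ^ 20 * (\<mu> * (\<mu> * L\<^sup>2)) \<le> k"
proof -
  have D: "3 \<le> real d" "0 < (real d - 1)\<^sup>2" using d by auto
  have quot: "x / (real d - 1) = x * (real d - 1) / (real d - 1)\<^sup>2" for x
    using D by (simp add: power2_eq_square)
  have e1: "2 * real d / (real d - 1) \<le> (2 * (real d)\<^sup>2 - 1) / (real d - 1)\<^sup>2"
    unfolding quot using D by (intro divide_right_mono) (auto simp: power2_eq_square algebra_simps)
  have e2: "4 * real d / (real d - 1) \<le> 2 * real d * (2 * real d - 1) / (real d - 1)\<^sup>2"
    unfolding quot using D by (intro divide_right_mono) (auto simp: power2_eq_square algebra_simps)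
  have e3: "4 / (real d - 1) + 2 \<le> 2 * (real d)\<^sup>2 / (real d - 1)\<^sup>2"
  proof -
    have "4 / (real d - 1) + 2 = (4 * (real d - 1) + 2 * (real d - 1)\<^sup>2) / (real d - 1)\<^sup>2"
      unfolding quot using D by (simp add: add_divide_distrib)
    also have "\<dots> \<le> 2 * (real d)\<^sup>2 / (real d - 1)\<^sup>2"
      using D by (intro divide_right_mono) (auto simp: power2_eq_square algebra_simps)
    finally show ?thesis .
  qed
  let ?R = "real r powr (2 * real d / (real d - 1))" and ?D = "real d powr (4 * real d / (real d - 1))"
    and ?L = "L powr (4 / (real d - 1))"
  have "2 ^ 20 * (\<mu> * (\<mu> * L\<^sup>2)) = 2 ^ 20 * (\<mu>\<^sup>2 * L\<^sup>2)" by (simp add: power2_eq_square)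
  also have "\<dots> \<le> 2 ^ 20 * ((2 ^ 84 * (?R * ?D * ?L)) * L\<^sup>2)"
    using \<mu> by (intro mult_left_mono mult_right_mono) auto
  also have "\<dots> = 2 ^ 104 * ?R * ?D * (?L * L powr 2)" using L by simp
  also have "?L * L powr 2 = L powr (4 / (real d - 1) + 2)" by (rule powr_add[symmetric])
  also have "2 ^ 104 * ?R * ?D * L powr (4 / (real d - 1) + 2)
      \<le> 2 ^ 104 * real r powr ((2 * (real d)\<^sup>2 - 1) / (real d - 1)\<^sup>2)
               * real d powr (2 * real d * (2 * real d - 1) / (real d - 1)\<^sup>2)
               * L powr (2 * (real d)\<^sup>2 / (real d - 1)\<^sup>2)"
    using e1 e2 e3 r D L by (intro mult_mono powr_mono mult_nonneg_nonneg) auto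
  also have "\<dots> \<le> k" by (rule k)
  finally show ?thesis .
qed

section \<open>From colourings to Ramsey numbers\<close>

text \<open>By minimality, one vertex less than the Ramsey number admits a colouring without
  monochromatic cliques of size \<open>k\<close>; the \<open>+ 1\<close> in the hypothesis restores
  that vertex.\<close>

lemma ramsey_number_le:
  fixes b :: real
  assumes r: "2 \<le> r" and b: "0 \<le> b"
    and bound: "\<And>(col :: nat \<Rightarrow> nat \<Rightarrow> nat) V. edge_coloring col r \<Longrightarrow> finite V \<Longrightarrow>
      (\<And>i. i < r \<Longrightarrow> edge_coloring.clique_free col i V k) \<Longrightarrow> real (card V) + 1 \<le> b"
  shows "real (ramsey_number r k) \<le> b"
proof (cases "ramsey_number r k")
  case 0
  then show ?thesis using b by simp
next
  case (Suc n)
  then have "\<not> partn {..<n} k 2 {..<r}"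
    unfolding ramsey_number_def by (intro not_less_Least) simp
  then obtain f where f: "f \<in> nsets {..<n} 2 \<rightarrow> {..<r}"
    and nf: "\<And>H \<xi>. H \<in> nsets {..<n} k \<Longrightarrow> \<xi> < r \<Longrightarrow> \<not> f ` nsets H 2 \<subseteq> {\<xi>}"
    unfolding partn_def monochromatic_def by blast
  \<comment> \<open>Colour 0 is a dummy off the edges of the complete graph.\<close>
  define col where "col x y = (if x < n \<and> y < n \<and> x \<noteq> y then f {x, y} else 0)" for x y
  have col: "edge_coloring col r"
  proof
    show "col x y = col y x" for x y by (auto simp: col_def insert_commute)
    have "f {x, y} < r" if "x < n" "y < n" "x \<noteq> y" for x y
      using f that by (auto simp: nsets_def Pi_def)
    then show "col x y < r" for x y using r by (auto simp: col_def)
  qed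
  have "real (card {..<n}) + 1 \<le> b"
  proof (rule bound[OF col])
    fix i assume i: "i < r"
    show "edge_coloring.clique_free col i {..<n} k"
      unfolding edge_coloring.clique_free_def[OF col]
    proof (rule notI, elim exE conjE)
      fix S assume S: "S \<subseteq> {..<n}" "finite S" "card S = k" "\<forall>x\<in>S. \<forall>y\<in>S. x \<noteq> y \<longrightarrow> col x y = i"
      have "f ` nsets S 2 \<subseteq> {i}"
      proof
        fix c assume "c \<in> f ` nsets S 2"
        then obtain x y where "c = f {x, y}" "x \<in> S" "y \<in> S" "x \<noteq> y"
          by (auto elim!: nsets2_E)
        moreover from this have "x < n" "y < n" using S(1) by auto
        ultimately show "c \<in> {i}" using S(4) by (auto simp: col_def split: if_splits)
      qed
      then show False using nf[of S i] S i by (simp add: nsets_def)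
    qed
  qed simp
  then show ?thesis using Suc by simp
qed

theorem theorem1p2:
  shows "\<exists>c>0. \<exists>K>0. \<forall>r k d :: nat.
    2 \<le> r \<longrightarrow> 2 \<le> k \<longrightarrow> 3 \<le> d \<longrightarrow> real d \<le> max 3 (ln (2 * real r)) \<longrightarrow>
    real k \<ge> K * real r powr ((2 * (real d)\<^sup>2 - 1) / (real d - 1)\<^sup>2)
               * real d powr (2 * real d * (2 * real d - 1) / (real d - 1)\<^sup>2)
               * ln (2 * real r * real d) powr (2 * (real d)\<^sup>2 / (real d - 1)\<^sup>2) \<longrightarrow>
    real (ramsey_number r k)
      \<le> exp (- (c * (real k /
                (real r powr (2 * real d / (real d - 1))
                 * real d powr (4 * real d / (real d - 1))
                 * ln (2 * real r * real d) powr (4 / (real d - 1))))))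
        * real r ^ (r * k)"
proof -
  have "real (ramsey_number r k)
      \<le> exp (- (1 / 2 ^ 96 * (real k /
                (real r powr (2 * real d / (real d - 1))
                 * real d powr (4 * real d / (real d - 1))
                 * ln (2 * real r * real d) powr (4 / (real d - 1))))))
        * real r ^ (r * k)"
    if r: "2 \<le> r" and d: "3 \<le> d" and dr: "real d \<le> max 3 (ln (2 * real r))"
      and k: "2 ^ 104 * real r powr ((2 * (real d)\<^sup>2 - 1) / (real d - 1)\<^sup>2)
               * real d powr (2 * real d * (2 * real d - 1) / (real d - 1)\<^sup>2)
               * ln (2 * real r * real d) powr (2 * (real d)\<^sup>2 / (real d - 1)\<^sup>2) \<le> real k"
    for r k d :: nat
  proof -
    define L where "L = ln (2 * real r * real d)"
    define X where "X = real r powr (2 * real d / (real d - 1))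
      * real d powr (4 * real d / (real d - 1)) * L powr (4 / (real d - 1))"
    have L: "2 \<le> L" "3 * ln 2 \<le> L" "ln (2 * real r) \<le> L" "L \<le> 4 * ln r"
      using log_bounds[OF r d dr] by (simp_all add: L_def)
    obtain \<mu> where \<mu>: "2 ^ 28 * real r \<le> \<mu>"
      "2 ^ 18 * (\<mu> * L\<^sup>2) * (768 * real r * (real d)\<^sup>2) ^ d \<le> \<mu> ^ d"
      "ln (8192 * real r * \<mu>) \<le> 24 * L"
      and \<mu>X: "\<mu>\<^sup>2 \<le> 2 ^ 84 * X"
      using parameter_exists[OF r d] L unfolding L_def X_def by blast
    have rd: "2 \<le> real r" "3 \<le> real d" using r d by auto
    have "real r * 6 \<le> real r * (2 * real d)" using rd by (intro mult_left_mono) auto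
    moreover have "exp L = real r * (2 * real d)" using rd by (simp add: L_def)
    ultimately have "4 * real r + 2 \<le> exp L" using rd by linarith
    then obtain m :: nat where m: "4 * real r + 2 \<le> 4 ^ m" "m \<le> 2 * L"
      using ex_power_of_4[OF L(1)] by blast
    have size: "2 ^ 20 * (\<mu> * (\<mu> * L\<^sup>2)) \<le> real k"
      using size_bound[OF r d L(1) \<mu>X[unfolded X_def]] k unfolding L_def by blast
    have "real (ramsey_number r k) \<le> exp (- (k / (4096 * \<mu>\<^sup>2))) * real r ^ (r * k)"
    proof (rule ramsey_number_le[OF r])
      fix col :: "nat \<Rightarrow> nat \<Rightarrow> nat" and V
      assume "edge_coloring col r" and V: "finite V"
        "\<And>i. i < r \<Longrightarrow> edge_coloring.clique_free col i V k"
      then interpret edge_coloring col r by simp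
      show "real (card V) + 1 \<le> exp (- (k / (4096 * \<mu>\<^sup>2))) * real r ^ (r * k)"
        by (rule coloring_bound[OF r d m L(1,3,4) \<mu> size V])
    qed simp
    also have "\<dots> \<le> exp (- (1 / 2 ^ 96 * (real k / X))) * real r ^ (r * k)"
    proof (intro mult_right_mono)
      have "0 < \<mu>" using \<mu>(1) rd by simp
      \<comment> \<open>2^96 is 4096 times the 2^84 from the bound on \<open>\<mu>\<^sup>2\<close>;
        this is the source of the constant c.\<close>
      then have "real k / (2 ^ 96 * X) \<le> k / (4096 * \<mu>\<^sup>2)"
        using \<mu>X by (intro frac_le) auto
      then show "exp (- (k / (4096 * \<mu>\<^sup>2))) \<le> exp (- (1 / 2 ^ 96 * (real k / X)))" by simp
    qed simp
    finally show ?thesis unfolding X_def L_def .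
  qed
  then show ?thesis
    by (intro exI[of _ "1 / 2 ^ 96"] exI[of _ "2 ^ 104"] conjI) auto
qed

end
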